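(* Let $m\ge 0$ and $r\ge 1$ be integers, and write $m=a\binom{r+1}{2}+b$ with $a\ge 0$ an integer and $0\le b<\binom{r+1}{2}$. If $G$ is a graph with exactly $m$ edges and maximum degree $\Delta(G)\le r$, then \[ \kappa(G)\le \kappa\bigl(aK_{r+1}\cup \mathcal{C}(b)\bigr), \] with equality if and only if, disregarding isolated vertices, $G$ is isomorphic to $aK_{r+1}\cup \mathcal{C}(b)$, or $b=\binom{c}{2}+1$ for some integer $c\ge 2$ and $G$ is isomorphic to $aK_{r+1}\cup K_c\cup K_2$.
   Context: All graphs are finite and simple. For a graph $G$ and $t\ge 2$, $k_t(G)$ denotes the number of cliques (complete subgraphs) of $G$ on exactly $t$ vertices, and $\kappa(G)=\sum_{t\ge 2}k_t(G)$ is the number of cliques of size at least $2$. The colexicographic (colex) order on $2$-element subsets of the positive integers is: $\{i<j\}$ precedes $\{i'<j'\}$ iff $j<j'$, or $j=j'$ and $i<i'$. The colex graph $\mathcal{C}(m)$ is the graph on vertex set the positive integers whose edges are the first $m$ pairs in colex order (equivalently, up to isolated vertices, if $m=\binom{c}{2}+d$ with $0\le d<c$, it is a clique on $c$ vertices together with one more vertex adjacent to exactly $d$ vertices of that clique). $\cup$ denotes disjoint union and $aK_{r+1}$ denotes $a$ disjoint copies of the complete graph $K_{r+1}$. *)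

theory Defs
  imports Complex_Main
begin

record 'a graph =
  verts :: "'a set"
  edges :: "'a set set"

(* Finiteness of the vertex set is kept separate, because the colex graph lives on all
   positive integers. *)
definition simple_graph :: "'a graph \<Rightarrow> bool" where
  "simple_graph G \<longleftrightarrow> (\<forall>e\<in>edges G. e \<subseteq> verts G \<and> card e = 2)"

definition degree :: "'a graph \<Rightarrow> 'a \<Rightarrow> nat" where
  "degree G v = card {e \<in> edges G. v \<in> e}"

(* The inserted 0 only matters for the graph without vertices. *)
definition max_degree :: "'a graph \<Rightarrow> nat" where
  "max_degree G = Max (insert 0 (degree G ` verts G))"

definition is_clique :: "'a graph \<Rightarrow> 'a set \<Rightarrow> bool" where
  "is_clique G S \<longleftrightarrow> S \<subseteq> verts G \<and> (\<forall>u\<in>S. \<forall>v\<in>S. u \<noteq> v \<longrightarrow> {u, v} \<in> edges G)"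

definition num_cliques :: "nat \<Rightarrow> 'a graph \<Rightarrow> nat" where
  "num_cliques t G = card {S. is_clique G S \<and> finite S \<and> card S = t}"

(* The sum over all t \<ge> 2 is restricted to its nonzero terms, since a sum over an infinite
   index set is 0 by convention. *)
definition kappa :: "'a graph \<Rightarrow> nat" where
  "kappa G = (\<Sum>t | 2 \<le> t \<and> num_cliques t G \<noteq> 0. num_cliques t G)"

definition complete_graph :: "nat \<Rightarrow> nat graph" where
  "complete_graph n = \<lparr>verts = {1..n}, edges = {e. e \<subseteq> {1..n} \<and> card e = 2}\<rparr>"

definition pos_pairs :: "nat set set" where
  "pos_pairs = {{i, j} | i j. 1 \<le> i \<and> i < j}"

definition colex_less :: "nat set \<Rightarrow> nat set \<Rightarrow> bool" where
  "colex_less e f \<longleftrightarrow> (\<exists>i j i' j'. e = {i, j} \<and> i < j \<and> f = {i', j'} \<and> i' < j' \<and>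
     (j < j' \<or> j = j' \<and> i < i'))"

(* A pair is among the first m pairs iff fewer than m pairs precede it; every pair has only
   finitely many predecessors. *)
definition colex_graph :: "nat \<Rightarrow> nat graph" where
  "colex_graph m = \<lparr>verts = {1..},
     edges = {e \<in> pos_pairs. card {f \<in> pos_pairs. colex_less f e} < m}\<rparr>"

definition disj_union :: "'a graph \<Rightarrow> 'b graph \<Rightarrow> ('a + 'b) graph" (infixl "\<uplus>" 65) where
  "G \<uplus> H = \<lparr>verts = verts G <+> verts H,
     edges = ((`) Inl ` edges G) \<union> ((`) Inr ` edges H)\<rparr>"

definition copies :: "nat \<Rightarrow> 'a graph \<Rightarrow> (nat \<times> 'a) graph" where
  "copies a G = \<lparr>verts = {..<a} \<times> verts G,
     edges = {Pair i ` e | i e. i < a \<and> e \<in> edges G}\<rparr>"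

definition graph_iso :: "'a graph \<Rightarrow> 'b graph \<Rightarrow> bool" where
  "graph_iso G H \<longleftrightarrow> (\<exists>f. bij_betw f (verts G) (verts H) \<and>
     (\<forall>u\<in>verts G. \<forall>v\<in>verts G. {u, v} \<in> edges G \<longleftrightarrow> {f u, f v} \<in> edges H))"

definition remove_isolated :: "'a graph \<Rightarrow> 'a graph" where
  "remove_isolated G = \<lparr>verts = {v \<in> verts G. \<exists>e\<in>edges G. v \<in> e}, edges = edges G\<rparr>"

definition iso_upto_isolated :: "'a graph \<Rightarrow> 'b graph \<Rightarrow> bool" where
  "iso_upto_isolated G H \<longleftrightarrow> graph_iso (remove_isolated G) (remove_isolated H)"

lemma finite_colex_predecessors: "finite {f \<in> pos_pairs. colex_less f e}"
proof (cases "finite e")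
  case True
  have "{f \<in> pos_pairs. colex_less f e} \<subseteq> Pow {..Max e}"
  proof
    fix f assume "f \<in> {f \<in> pos_pairs. colex_less f e}"
    then obtain i j i' j' where *: "f = {i, j}" "i < j" "e = {i', j'}" "i' < j'" "j \<le> j'"
      unfolding colex_less_def by auto
    then have "j' \<le> Max e" by simp
    with * show "f \<in> Pow {..Max e}" by auto
  qed
  then show ?thesis by (rule finite_subset) simp
next
  case False
  then have "{f \<in> pos_pairs. colex_less f e} = {}"
    unfolding colex_less_def by auto
  then show ?thesis by (simp only: finite.emptyI)
qed

lemma kappa_eq_card:
  assumes "simple_graph G" "finite (edges G)"
  shows "kappa G = card {S. is_clique G S \<and> finite S \<and> 2 \<le> card S}"
proof -
  let ?A = "{S. is_clique G S \<and> finite S \<and> 2 \<le> card S}"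
  let ?C = "\<lambda>t. {S. is_clique G S \<and> finite S \<and> card S = t}"
  let ?T = "{t. 2 \<le> t \<and> num_cliques t G \<noteq> 0}"
  have "finite (\<Union>(edges G))"
    using assms by (intro finite_Union) (auto simp: simple_graph_def intro: card_ge_0_finite)
  moreover have "S \<subseteq> \<Union>(edges G)" if "S \<in> ?A" for S
  proof
    fix u assume u: "u \<in> S"
    from that have "\<not> S \<subseteq> {u}"
      using card_mono[of "{u}" S] by auto
    then obtain v where "v \<in> S" "v \<noteq> u" by auto
    with u that have "{u, v} \<in> edges G" by (auto simp: is_clique_def)
    then show "u \<in> \<Union>(edges G)" by blast
  qed
  ultimately have fin: "finite ?A"
    by (intro finite_subset[of ?A "Pow (\<Union>(edges G))"]) auto
  have finC: "finite (?C t)" if "2 \<le> t" for t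
    using that by (intro finite_subset[OF _ fin]) auto
  have T: "?T = card ` ?A"
    using finC by (auto simp: num_cliques_def card_gt_0_iff image_iff)
  have "card ?A = card (\<Union>t\<in>?T. ?C t)"
    by (rule arg_cong[where f = card]) (unfold T, auto)
  also have "\<dots> = (\<Sum>t\<in>?T. card (?C t))"
    using fin T finC by (intro card_UN_disjoint) auto
  finally show ?thesis by (simp add: kappa_def num_cliques_def)
qed

end

theory Submission
  imports Defs
begin

text \<open>
  Write \<open>g b\<close> for the number of cliques of the colex graph with \<open>b\<close> edges and let
  \<open>b = c(c-1)/2 + j\<close> with \<open>j < c\<close>. The proof is by induction on the number of edges. A
  vertex of degree \<open>d < c\<close> lies in at most \<open>2\<^sup>d - 1\<close> cliques, and deleting it
  suffices because \<open>g (b - d) + 2\<^sup>d - 1 \<le> g b\<close>, with equality only for \<open>d =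
  j\<close> and \<open>d = c - 1\<close>. If all degrees are at least \<open>c\<close>, a double count in the
  style of Chase provides a vertex \<open>v\<close>, of degree \<open>d\<close> say, for which the cliques of size
  at least 3 that touch the closed neighbourhood of \<open>v\<close> and avoid \<open>v\<close> are no more
  numerous than the subsets of size at least 3 of a \<open>d\<close>-set. The cliques containing \<open>v\<close>
  are bounded by induction, applied to the graph induced on the neighbours of \<open>v\<close>. Deleting the closed
  neighbourhood removes more than \<open>b\<close> edges, so the bound loses edges of a full
  \<open>K\<^bsub>r+1\<^esub>\<close>, which are the most valuable ones; this leaves equality only if the closed
  neighbourhood is itself a component \<open>K\<^bsub>r+1\<^esub>\<close>.
\<close>

section \<open>The clique numbers of colex graphs\<close>

text \<open>A vertex of degree \<open>d < c\<close> takes its edges from the remainder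
  \<open>b\<close> alone, and convexity of powers of two pays for \<open>2^d - 1\<close> cliques.
  From degree \<open>c\<close> on, \<open>2^d - 1\<close> can exceed what the remainder loses, so a
  closed neighbourhood is deleted instead and compared with \<open>K_{d+1}\<close>. Its cliques are
  charged in three kinds: edges, larger cliques through the centre, larger cliques avoiding the
  centre. In \<open>K_{d+1}\<close> these number \<open>d + 1 choose 2\<close>,
  \<open>g (d choose 2)\<close> and \<open>g (d choose 2) - (d choose 2)\<close>; the last is the
  quantity in the double count, hence its restriction to size at least 3. If more edges than those
  of \<open>K_{d+1}\<close> meet the neighbourhood, each extra edge is worth at least one clique in
  the bound, which cancels its own charge. If \<open>w\<close> are missing, at least
  \<open>w\<close> pairs of neighbours of the centre are not adjacent, and minimum degree
  \<open>c\<close> gives \<open>2w \<le> d(d - c)\<close>, enough to absorb the loss.\<close>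

lemma choose_two_Suc: "Suc c choose 2 = (c choose 2) + c"
  by (simp add: numeral_2_eq_2)

lemma choose_two_mono: "c \<le> c' \<Longrightarrow> c choose 2 \<le> c' choose 2"
  by (rule binomial_right_mono)

lemma double_choose_two: "2 * int (d choose 2) = int d * (int d - 1)"
  by (induction d) (auto simp: choose_two_Suc algebra_simps)

lemma colex_representation: "\<exists>c j. b = (c choose 2) + j \<and> j < c"
proof (induction b)
  case 0
  have "0 = (1 choose 2) + (0::nat) \<and> 0 < (1::nat)" by simp
  then show ?case by blast
next
  case (Suc b)
  then obtain c j where *: "b = (c choose 2) + j" "j < c" by blast
  show ?case
  proof (cases "Suc j < c")
    case True
    with * have "Suc b = (c choose 2) + Suc j \<and> Suc j < c" by simp
    then show ?thesis by blast
  next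
    case False
    with * have "Suc b = (Suc c choose 2) + 0 \<and> 0 < Suc c" by (simp add: choose_two_Suc)
    then show ?thesis by blast
  qed
qed

lemma colex_root_le:
  assumes "(c choose 2) + j \<le> (c' choose 2) + j'" "j' < c'"
  shows "c \<le> c'"
proof (rule ccontr)
  assume "\<not> c \<le> c'"
  then have "Suc c' choose 2 \<le> c choose 2" by (intro choose_two_mono) simp
  with assms show False by (simp add: choose_two_Suc)
qed

lemma colex_representation_unique:
  assumes "(c choose 2) + j = (c' choose 2) + j'" "j < c" "j' < c'"
  shows "c = c'" "j = j'"
proof -
  show "c = c'" using colex_root_le[of c j c' j'] colex_root_le[of c' j' c j] assms by simp
  with assms show "j = j'" by simp
qed

definition colex_root :: "nat \<Rightarrow> nat" where
  "colex_root b = (THE c. \<exists>j. b = (c choose 2) + j \<and> j < c)"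

text \<open>With \<open>b = c(c-1)/2 + j\<close>, the clique on \<open>c\<close> vertices contributes \<open>2\<^sup>c - c - 1\<close> and the
  additional vertex of degree \<open>j\<close> contributes \<open>2\<^sup>j - 1\<close>.\<close>

definition colex_kappa :: "nat \<Rightarrow> int" where
  "colex_kappa b = (let c = colex_root b in 2 ^ c + 2 ^ (b - (c choose 2)) - int c - 2)"

lemma colex_kappa_less:
  assumes "j < c"
  shows "colex_kappa ((c choose 2) + j) = 2 ^ c + 2 ^ j - int c - 2"
proof -
  have "colex_root ((c choose 2) + j) = c"
    unfolding colex_root_def
    by (rule the_equality) (use assms colex_representation_unique in blast)+
  then show ?thesis by (simp add: colex_kappa_def)
qed

text \<open>At \<open>j = c\<close> the last row is complete, and \<open>(c, c)\<close> and
  \<open>(c + 1, 0)\<close> describe the same number with the same value. Admitting both lets later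
  proofs fill or empty a row without a case distinction.\<close>

lemma colex_kappa_eq:
  assumes "j \<le> c"
  shows "colex_kappa ((c choose 2) + j) = 2 ^ c + 2 ^ j - int c - 2"
proof (cases "j = c")
  case True
  then show ?thesis
    using colex_kappa_less[of 0 "Suc c"] by (simp add: choose_two_Suc)
qed (use assms colex_kappa_less[of j c] in simp)

lemma colex_kappa_choose_two: "colex_kappa (c choose 2) = 2 ^ c - int c - 1"
  using colex_kappa_eq[of 0 c] by simp

lemma colex_kappa_0 [simp]: "colex_kappa 0 = 0"
  using colex_kappa_choose_two[of 0] by (simp add: binomial_eq_0)

lemma colex_kappa_Suc: "colex_kappa x + 1 \<le> colex_kappa (Suc x)"
proof -
  obtain c j where *: "x = (c choose 2) + j" "j < c" using colex_representation by blast
  then show ?thesis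
    using colex_kappa_eq[of j c] colex_kappa_eq[of "Suc j" c] by simp
qed

lemma colex_kappa_add: "colex_kappa x + int k \<le> colex_kappa (x + k)"
proof (induction k)
  case (Suc k)
  then show ?case using colex_kappa_Suc[of "x + k"] by simp
qed simp

lemma colex_kappa_mono: "x \<le> y \<Longrightarrow> colex_kappa x \<le> colex_kappa y"
  using colex_kappa_add[of x "y - x"] by simp

lemma colex_kappa_strict_mono: "x < y \<Longrightarrow> colex_kappa x < colex_kappa y"
  using colex_kappa_add[of x "y - x"] by simp

text \<open>Repeatedly moving edges from the smaller to the larger colex graph, as many as complete the
  last row of the one or exhaust the last row of the other, never loses cliques.\<close>

lemma colex_kappa_exchange_ordered:
  assumes "p' \<le> p" "p \<le> n choose 2" "n choose 2 \<le> p + p'"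
  shows "colex_kappa p + colex_kappa p' \<le> colex_kappa (n choose 2) + colex_kappa (p + p' - (n choose 2)) \<and>
    (p < n choose 2 \<longrightarrow>
     colex_kappa p + colex_kappa p' < colex_kappa (n choose 2) + colex_kappa (p + p' - (n choose 2)))"
  using assms
proof (induction p' arbitrary: p rule: less_induct)
  case (less p')
  let ?M = "n choose 2"
  show ?case
  proof (cases "p = ?M")
    case False
    with less.prems have pM: "p < ?M" by simp
    with less.prems have p': "p' > 0" by simp
    obtain c j where p: "p = (c choose 2) + j" "j < c" using colex_representation by blast
    \<comment> \<open>Decomposing \<open>p' - 1\<close> makes the last row of \<open>p'\<close>
      nonempty and possibly complete, \<open>0 < j' \<le> c'\<close>, while the row of
      \<open>p\<close> is incomplete, \<open>j < c\<close>. Hence some edge can always move.\<close>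
    obtain c' k where k: "p' - 1 = (c' choose 2) + k" "k < c'" using colex_representation by blast
    define j' where "j' = Suc k"
    have p'': "p' = (c' choose 2) + j'" "0 < j'" "j' \<le> c'" using k p' by (auto simp: j'_def)
    have c'c: "c' \<le> c"
      using colex_root_le[of c' k c j] k p less.prems by simp
    have cn: "c < n"
    proof (rule ccontr)
      assume "\<not> c < n"
      then have "?M \<le> c choose 2" by (intro choose_two_mono) simp
      with p pM show False by simp
    qed
    have SM: "Suc c choose 2 \<le> ?M" using cn by (intro choose_two_mono) simp
    \<comment> \<open>Either the row of \<open>p'\<close> is exhausted, \<open>j' - t = 0\<close>,
      or the row of \<open>p\<close> is completed and
      \<open>j' - t \<le> c' - (c - j) \<le> j\<close>. In both cases the edges gain at least as
      much where they arrive as they lose where they leave.\<close>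
    define t where "t = min j' (c - j)"
    have t: "0 < t" "t \<le> j'" "t \<le> c - j" "j' - t \<le> j"
      using p p'' c'c by (auto simp: t_def)
    have ptM: "p + t \<le> ?M" using SM t p by (simp add: choose_two_Suc)
    have "j + t \<le> c" using t p by simp
    then have g1: "colex_kappa (p + t) - colex_kappa p = 2 ^ j * (2 ^ t - 1)"
      using colex_kappa_eq[of j c] colex_kappa_eq[of "j + t" c] p t
      by (simp add: algebra_simps power_add)
    have "j' - t \<le> c'" using p'' by simp
    moreover have "(2::int) ^ j' = 2 ^ (j' - t) * 2 ^ t"
      using t by (simp flip: power_add)
    ultimately have g2: "colex_kappa p' - colex_kappa (p' - t) = 2 ^ (j' - t) * (2 ^ t - 1)"
      using colex_kappa_eq[of j' c'] colex_kappa_eq[of "j' - t" c'] p'' t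
      by (simp add: algebra_simps)
    have tpos: "(2::int) ^ t - 1 > 0" using t(1) by simp
    have le: "(2::int) ^ (j' - t) \<le> 2 ^ j" using t by (intro power_increasing) auto
    have g12: "2 ^ (j' - t) * (2 ^ t - 1) \<le> 2 ^ j * ((2::int) ^ t - 1)"
      using le tpos by (intro mult_right_mono) auto
    have IH: "colex_kappa (p + t) + colex_kappa (p' - t) \<le> colex_kappa ?M + colex_kappa (p + p' - ?M)"
      "p + t < ?M \<Longrightarrow> colex_kappa (p + t) + colex_kappa (p' - t) < colex_kappa ?M + colex_kappa (p + p' - ?M)"
      using less.IH[of "p' - t" "p + t"] less.prems t ptM p' p'' by auto
    have "colex_kappa p + colex_kappa p' < colex_kappa ?M + colex_kappa (p + p' - ?M)"
    proof (cases "p + t < ?M")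
      case True
      then show ?thesis using IH(2) g1 g2 g12 by linarith
    next
      case False
      \<comment> \<open>Strictness must come from this last move, which completes the row of
        \<open>p\<close>. With \<open>j' - t = j\<close> the row of \<open>p'\<close> would be
        complete as well and \<open>c' = c\<close>, making \<open>p'\<close> larger than
        \<open>p\<close>.\<close>
      have "j' - t < j"
      proof (rule ccontr)
        assume "\<not> j' - t < j"
        with t have jt: "j' = j + t" by simp
        have "(Suc c choose 2) = p + t" using False ptM SM p t by (simp add: choose_two_Suc)
        with p have "j + t = c" by (simp add: choose_two_Suc)
        with jt p'' c'c have "c' = c" "j' = c" by auto
        with p'' p less.prems show False by simp
      qed
      then have "(2::int) ^ (j' - t) < 2 ^ j" by (intro power_strict_increasing) auto
      then have "2 ^ (j' - t) * (2 ^ t - 1) < 2 ^ j * ((2::int) ^ t - 1)"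
        using tpos by (intro mult_strict_right_mono) auto
      then show ?thesis using IH(1) g1 g2 by linarith
    qed
    then show ?thesis by simp
  qed simp
qed

lemma colex_kappa_exchange:
  assumes "p \<le> n choose 2" "p' \<le> n choose 2" "n choose 2 \<le> p + p'"
  shows "colex_kappa p + colex_kappa p' \<le> colex_kappa (n choose 2) + colex_kappa (p + p' - (n choose 2))"
    and "p < n choose 2 \<Longrightarrow> p' < n choose 2 \<Longrightarrow>
      colex_kappa p + colex_kappa p' < colex_kappa (n choose 2) + colex_kappa (p + p' - (n choose 2))"
  using colex_kappa_exchange_ordered[of p' p n] colex_kappa_exchange_ordered[of p p' n] assms
  by (cases "p' \<le> p"; force simp: add.commute)+

section \<open>Numerical inequalities for the two deletions\<close>

lemma two_power_convex:
  "(2::int) ^ (x + s) + 2 ^ (x + t) \<le> 2 ^ x + 2 ^ (x + s + t)"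
  "(2::int) ^ (x + s) + 2 ^ (x + t) = 2 ^ x + 2 ^ (x + s + t) \<Longrightarrow> s = 0 \<or> t = 0"
proof -
  have eq: "2 ^ x + 2 ^ (x + s + t) - ((2::int) ^ (x + s) + 2 ^ (x + t)) = 2 ^ x * ((2 ^ s - 1) * (2 ^ t - 1))"
    by (simp add: algebra_simps power_add)
  moreover have "2 ^ x * ((2 ^ s - 1) * ((2::int) ^ t - 1)) \<ge> 0" by simp
  ultimately show "(2::int) ^ (x + s) + 2 ^ (x + t) \<le> 2 ^ x + 2 ^ (x + s + t)" by linarith
  assume "(2::int) ^ (x + s) + 2 ^ (x + t) = 2 ^ x + 2 ^ (x + s + t)"
  with eq have "2 ^ x * ((2 ^ s - 1) * ((2::int) ^ t - 1)) = 0" by linarith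
  then have "\<not> ((2::int) ^ s > 1 \<and> (2::int) ^ t > 1)" by auto
  then show "s = 0 \<or> t = 0" by (cases "s = 0"; cases "t = 0") auto
qed

text \<open>For \<open>d \<le> j\<close> the removed edges come from the last row; otherwise that
  row disappears and \<open>d - j\<close> edges leave the row below. Both cases are instances of
  \<open>two_power_convex\<close>, whose equality cases yield the listed degrees.\<close>

lemma colex_kappa_remove_vertex:
  assumes "d < c" "j < c"
  shows "colex_kappa ((c choose 2) + j - d) + 2 ^ d - 1 \<le> colex_kappa ((c choose 2) + j)"
    and "colex_kappa ((c choose 2) + j - d) + 2 ^ d - 1 = colex_kappa ((c choose 2) + j) \<Longrightarrow>
      d = 0 \<or> d = j \<or> d = c - 1 \<and> j < d"
proof -
  have "colex_kappa ((c choose 2) + j - d) + 2 ^ d - 1 \<le> colex_kappa ((c choose 2) + j) \<and>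
   (colex_kappa ((c choose 2) + j - d) + 2 ^ d - 1 = colex_kappa ((c choose 2) + j) \<longrightarrow>
      d = 0 \<or> d = j \<or> d = c - 1 \<and> j < d)"
  proof (cases "d \<le> j")
    case True
    have "colex_kappa ((c choose 2) + j - d) = 2 ^ c + 2 ^ (j - d) - int c - 2"
      using colex_kappa_eq[of "j - d" c] True assms by simp
    moreover have "colex_kappa ((c choose 2) + j) = 2 ^ c + 2 ^ j - int c - 2"
      using colex_kappa_eq[of j c] assms by simp
    ultimately show ?thesis
      using two_power_convex[of 0 d "j - d"] True by auto
  next
    case False
    define k where "k = c - 1"
    define s where "s = d - j"
    define t where "t = k - d"
    have c: "c = Suc k" and d: "d = j + s" and k: "k = j + s + t" "0 < s"
      using assms False by (auto simp: k_def s_def t_def)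
    have "(c choose 2) + j - d = (k choose 2) + (j + t)"
      using c d k by (simp add: choose_two_Suc)
    then have "colex_kappa ((c choose 2) + j - d) = 2 ^ k + 2 ^ (j + t) - int k - 2"
      using colex_kappa_eq[of "j + t" k] k by simp
    moreover have "colex_kappa ((c choose 2) + j) = 2 * 2 ^ k + 2 ^ j - int k - 3"
      using colex_kappa_eq[of j c] assms c by simp
    ultimately show ?thesis
      using two_power_convex[of j s t] d k c by auto
  qed
  then show "colex_kappa ((c choose 2) + j - d) + 2 ^ d - 1 \<le> colex_kappa ((c choose 2) + j)"
    and "colex_kappa ((c choose 2) + j - d) + 2 ^ d - 1 = colex_kappa ((c choose 2) + j) \<Longrightarrow>
      d = 0 \<or> d = j \<or> d = c - 1 \<and> j < d" by blast+
qed

text \<open>Here \<open>w\<close> is the number of edges by which a closed neighbourhood falls short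
  of \<open>K_{d+1}\<close>, and \<open>deg\<close> is what minimum degree \<open>c\<close> gives.
  The exchange inequality settles \<open>b + w \<le> d choose 2\<close>; beyond that,
  \<open>deg\<close> leaves only \<open>d = c + 1\<close>, where explicit values can be
  compared.\<close>

lemma colex_kappa_window_less:
  assumes b: "b < Suc c choose 2" "c choose 2 \<le> b" and c: "c < d" "1 \<le> c" and w: "0 < w" "w \<le> d choose 2"
    and deg: "2 * int w \<le> int d * (int d - int c)"
  shows "colex_kappa (b + w) + colex_kappa ((d choose 2) - w) <
    colex_kappa (d choose 2) + colex_kappa b + int w"
proof (cases "b + w \<le> d choose 2")
  case True
  then show ?thesis using colex_kappa_exchange(1)[of "b + w" d "(d choose 2) - w"] w by simp
next
  case False
  have two_b: "2 * int b \<le> int c * (int c + 1) - 2"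
    using b(1) double_choose_two[of "Suc c"] by (simp add: algebra_simps)
  have "2 * int b + 2 * int w > int d * (int d - 1)"
    using False double_choose_two[of d] by simp
  \<comment> \<open>Combining \<open>d(d - 1) < 2b + 2w\<close> with
    \<open>2b \<le> (c - 1)(c + 2)\<close> and \<open>deg\<close> leaves the factor
    \<open>c - 1\<close> on both sides. For \<open>c = 1\<close> this is already a
    contradiction.\<close>
  then have "(int c - 1) * int d < (int c - 1) * (int c + 2)"
    using two_b deg by (simp add: algebra_simps)
  then have "int d < int c + 2" using c by (simp add: mult_less_cancel_left)
  with c have d: "d = Suc c" by simp
  obtain j where j: "b = (c choose 2) + j" using b le_iff_add by blast
  have jc: "j < c" using j b by (simp add: choose_two_Suc)
  have wd: "2 * w \<le> d" using deg d by simp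
  \<comment> \<open>The overshoot of \<open>b + w\<close> past a complete graph on \<open>d\<close>
    vertices; it is the length of the new last row.\<close>
  define u where "u = b + w - (d choose 2)"
  have u: "0 < u" "b + w = (d choose 2) + u" using False by (auto simp: u_def)
  have jw: "j + w = c + u" using u j d by (simp add: choose_two_Suc)
  have "colex_kappa (b + w) = 2 * 2 ^ c + 2 ^ u - int c - 3"
    using colex_kappa_eq[of u d] u d wd jw jc by simp
  moreover have "colex_kappa b = 2 ^ c + 2 ^ j - int c - 2"
    using colex_kappa_eq[of j c] j jc by simp
  moreover have "colex_kappa (d choose 2) = 2 * 2 ^ c - int c - 2"
    using colex_kappa_choose_two[of d] d by simp
  moreover have "colex_kappa ((d choose 2) - w) = 2 ^ c + 2 ^ (c - w) - int c - 2"
    using colex_kappa_eq[of "c - w" c] d wd c by (simp add: choose_two_Suc)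
  moreover have "c - w = j - u" "u \<le> j" using jw wd d by auto
  moreover have "(2::int) ^ u + 2 ^ (j - u) \<le> 1 + 2 ^ j"
    using two_power_convex(1)[of 0 u "j - u"] \<open>u \<le> j\<close> by simp
  ultimately show ?thesis using w by simp
qed

text \<open>Here \<open>s\<close> counts the edges meeting a closed neighbourhood and
  \<open>i\<close> those among the neighbours of the centre. With \<open>g = colex_kappa\<close> and
  \<open>B = d choose 2\<close>, the destroyed cliques are charged
  \<open>s' + g i + g B - B\<close>. Since \<open>g (Suc d choose 2) = 2 g B + d\<close>, this is
  the value of \<open>K_{d+1}\<close> if no edge is missing; otherwise the \<open>w\<close> missing
  edges go to the remainder and are handled by \<open>colex_kappa_window_less\<close>.\<close>

lemma colex_kappa_remove_neighbourhood:
  assumes b: "b < Suc c choose 2" "c choose 2 \<le> b" and c: "1 \<le> c" "c \<le> d" "d \<le> r"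
    and i: "i \<le> d choose 2" and s: "d + i \<le> s" "d * (c + 1) \<le> 2 * s"
    and s': "s' = min s (Suc d choose 2)"
  shows "b < s'"
    and "colex_kappa ((Suc r choose 2) + b - s') + int s' + colex_kappa i + colex_kappa (d choose 2)
      - int (d choose 2) \<le> colex_kappa (Suc r choose 2) + colex_kappa b"
    and "colex_kappa ((Suc r choose 2) + b - s') + int s' + colex_kappa i + colex_kappa (d choose 2)
      - int (d choose 2) = colex_kappa (Suc r choose 2) + colex_kappa b \<Longrightarrow>
      d = r \<and> i = d choose 2"
proof -
  let ?N = "Suc r choose 2" and ?D = "Suc d choose 2" and ?B = "d choose 2"
  let ?L = "colex_kappa (?N + b - s') + int s' + colex_kappa i + colex_kappa ?B - int ?B"
  let ?R = "colex_kappa ?N + colex_kappa b"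
  have DN: "?D \<le> ?N" "Suc c choose 2 \<le> ?D" using c by (auto intro!: choose_two_mono)
  \<comment> \<open>The degree condition gives at least \<open>Suc c choose 2\<close> deleted edges,
    more than the remainder holds.\<close>
  have "c * (c + 1) \<le> d * (c + 1)" using c by (intro mult_right_mono) auto
  moreover have "2 * (Suc c choose 2) = c * (c + 1)"
    using double_choose_two[of "Suc c"] by (simp flip: of_nat_eq_iff[where 'a = int] add: algebra_simps)
  ultimately have "Suc c choose 2 \<le> s" using s by linarith
  then show bs: "b < s'" using b DN s' by simp
  define w where "w = ?D - s'"
  have w: "s' = ?D - w" "w \<le> ?D" using s' by (auto simp: w_def)
  have wB: "w + i \<le> ?B" using s i by (auto simp: w_def s' choose_two_Suc)
  have DB: "?D = ?B + d" by (simp add: choose_two_Suc)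
  have gD: "colex_kappa ?D = 2 * colex_kappa ?B + int d"
    using colex_kappa_choose_two[of "Suc d"] colex_kappa_choose_two[of d] by simp
  \<comment> \<open>A \<open>K_{d+1}\<close> and a graph with \<open>?N + b - s'\<close> edges are
    exchanged for a full \<open>K_{r+1}\<close> and a graph with \<open>b + w\<close> edges, with
    strict gain if \<open>d < r\<close>.\<close>
  have ex: "colex_kappa ?D + colex_kappa (?N + b - s') \<le> colex_kappa ?N + colex_kappa (b + w)"
    "d < r \<Longrightarrow> colex_kappa ?D + colex_kappa (?N + b - s') < colex_kappa ?N + colex_kappa (b + w)"
  proof -
    have eq: "?D + (?N + b - s') - ?N = b + w" using w DN by simp
    show "colex_kappa ?D + colex_kappa (?N + b - s') \<le> colex_kappa ?N + colex_kappa (b + w)"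
      using colex_kappa_exchange(1)[of ?D "Suc r" "?N + b - s'"] DN bs w eq by simp
    assume "d < r"
    then have "?N \<ge> Suc (Suc d) choose 2" by (intro choose_two_mono) simp
    then have "?D < ?N" by (simp add: choose_two_Suc)
    then show "colex_kappa ?D + colex_kappa (?N + b - s') < colex_kappa ?N + colex_kappa (b + w)"
      using colex_kappa_exchange(2)[of ?D "Suc r" "?N + b - s'"] DN bs w eq by simp
  qed
  have win: "colex_kappa (b + w) + colex_kappa i \<le> colex_kappa ?B + colex_kappa b + int w \<and>
    (i < ?B \<longrightarrow> colex_kappa (b + w) + colex_kappa i < colex_kappa ?B + colex_kappa b + int w)"
  proof (cases "w = 0")
    case True
    then show ?thesis using colex_kappa_mono[of i ?B] colex_kappa_strict_mono[of i ?B] i by simp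
  next
    case False
    \<comment> \<open>A positive deficiency means that the cap in \<open>s'\<close> is inactive, so
      the degree bound on \<open>s\<close> applies and forces \<open>c < d\<close>.\<close>
    then have "s' = s" "w = ?D - s" "s \<le> ?D" by (auto simp: w_def s')
    then have "2 * int w = 2 * int ?D - int (2 * s)" by simp
    also have "\<dots> \<le> int (Suc d) * int d - int (d * (c + 1))"
      using double_choose_two[of "Suc d"] of_nat_mono[OF s(2), where 'a = int] by simp
    finally have deg: "2 * int w \<le> int d * (int d - int c)" by (simp add: algebra_simps)
    with False c have "0 < int d * (int d - int c)" by linarith
    then have "c < d" by (simp add: zero_less_mult_iff)
    then have "colex_kappa (b + w) + colex_kappa (?B - w) < colex_kappa ?B + colex_kappa b + int w"
      using colex_kappa_window_less[of b c d w] b c False wB deg by simp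
    moreover have "colex_kappa i \<le> colex_kappa (?B - w)" using wB by (intro colex_kappa_mono) simp
    ultimately show ?thesis by linarith
  qed
  have s'int: "int s' = int ?B + int d - int w" using w DB by simp
  show "?L \<le> ?R" using ex(1) win gD s'int by linarith
  assume "?L = ?R"
  then have "\<not> d < r" "\<not> i < ?B" using ex win gD s'int by linarith+
  then show "d = r \<and> i = ?B" using c i by simp
qed

section \<open>The bound as a function of the number of edges\<close>

definition clique_bound :: "nat \<Rightarrow> nat \<Rightarrow> int" where
  "clique_bound N m = int (m div N) * colex_kappa N + colex_kappa (m mod N)"

lemma clique_bound_eq:
  "b < N \<Longrightarrow> clique_bound N (a * N + b) = int a * colex_kappa N + colex_kappa b"
  by (simp add: clique_bound_def)

text \<open>Within a remainder this is \<open>colex_kappa_Suc\<close>; when the remainder reaches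
  \<open>N\<close>, it becomes one more full block and restarts at value 0. The lemma refunds edges
  that are deleted in excess.\<close>

lemma clique_bound_add:
  assumes "0 < N"
  shows "clique_bound N x + int k \<le> clique_bound N (x + k)"
proof (induction k)
  case (Suc k)
  let ?y = "x + k"
  have y: "?y = (?y div N) * N + ?y mod N" by simp
  have "clique_bound N ?y + 1 \<le> clique_bound N (Suc ?y)"
  proof (cases "Suc (?y mod N) < N")
    case True
    have "clique_bound N (Suc ?y) = int (?y div N) * colex_kappa N + colex_kappa (Suc (?y mod N))"
      using clique_bound_eq[OF True, of "?y div N"] y by (metis add_Suc_right)
    then show ?thesis using colex_kappa_Suc[of "?y mod N"] by (simp add: clique_bound_def)
  next
    case False
    then have N: "Suc (?y mod N) = N" using assms by (metis Suc_lessI mod_less_divisor)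
    then have "Suc ?y = Suc (?y div N) * N + 0" using y by (metis add.commute add_Suc_right add_0_right mult_Suc)
    then have "clique_bound N (Suc ?y) = int (Suc (?y div N)) * colex_kappa N"
      using clique_bound_eq[of 0 N "Suc (?y div N)"] assms by simp
    then show ?thesis using colex_kappa_Suc[of "?y mod N"] N by (simp add: clique_bound_def algebra_simps)
  qed
  with Suc show ?case by simp
qed simp

section \<open>Cliques in a set of edges\<close>

text \<open>Edge sets replace graphs here: isolated vertices lie in no clique of size at least 2,
  and the isomorphisms in question ignore them.\<close>

definition simple_edges :: "'a set set \<Rightarrow> bool" where
  "simple_edges E \<longleftrightarrow> finite E \<and> (\<forall>e\<in>E. card e = 2)"

text \<open>Sets with at most one element are complete wherever they lie, even outside
  \<open>\<Union>E\<close>. This matters when a neighbour of a deleted vertex becomes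
  isolated.\<close>

definition complete_on :: "'a set set \<Rightarrow> 'a set \<Rightarrow> bool" where
  "complete_on E S \<longleftrightarrow> (\<forall>u\<in>S. \<forall>v\<in>S. u \<noteq> v \<longrightarrow> {u, v} \<in> E)"

definition cliques :: "'a set set \<Rightarrow> 'a set set" where
  "cliques E = {S. finite S \<and> 2 \<le> card S \<and> complete_on E S}"

definition clique_count :: "'a set set \<Rightarrow> nat" where
  "clique_count E = card (cliques E)"

definition nbrs :: "'a set set \<Rightarrow> 'a \<Rightarrow> 'a set" where
  "nbrs E v = {u. {v, u} \<in> E}"

definition pairs :: "'a set \<Rightarrow> 'a set set" where
  "pairs X = {e. e \<subseteq> X \<and> card e = 2}"

definition star :: "'a \<Rightarrow> 'a set \<Rightarrow> 'a set set" where
  "star w D = (\<lambda>x. {w, x}) ` D"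

definition avoiding :: "'a set set \<Rightarrow> 'a set \<Rightarrow> 'a set set" where
  "avoiding E A = {e \<in> E. e \<inter> A = {}}"

definition induced :: "'a set set \<Rightarrow> 'a set \<Rightarrow> 'a set set" where
  "induced E X = {e \<in> E. e \<subseteq> X}"

lemma simple_edges_subset: "simple_edges E \<Longrightarrow> F \<subseteq> E \<Longrightarrow> simple_edges F"
  by (auto simp: simple_edges_def intro: finite_subset)

lemma simple_edges_Un: "simple_edges E \<Longrightarrow> simple_edges F \<Longrightarrow> simple_edges (E \<union> F)"
  by (auto simp: simple_edges_def)

lemma simple_edges_avoiding: "simple_edges E \<Longrightarrow> simple_edges (avoiding E A)"
  by (erule simple_edges_subset) (auto simp: avoiding_def)

lemma simple_edges_pairs: "finite X \<Longrightarrow> simple_edges (pairs X)"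
  unfolding simple_edges_def pairs_def by (auto intro: finite_subset[of _ "Pow X"])

lemma simple_edges_star: "finite D \<Longrightarrow> w \<notin> D \<Longrightarrow> simple_edges (star w D)"
  by (auto simp: simple_edges_def star_def card_2_iff)

lemma pair_in_pairs [simp]: "{x, y} \<in> pairs X \<longleftrightarrow> x \<in> X \<and> y \<in> X \<and> x \<noteq> y"
  by (auto simp: pairs_def card_2_iff doubleton_eq_iff)

lemma card_pairs: "finite X \<Longrightarrow> card (pairs X) = card X choose 2"
  by (simp add: pairs_def n_subsets)

lemma card_star: "w \<notin> D \<Longrightarrow> card (star w D) = card D"
  unfolding star_def by (intro card_image) (auto simp: inj_on_def doubleton_eq_iff)

lemma edge_cases:
  assumes "simple_edges E" "e \<in> E"
  obtains x y where "e = {x, y}" "x \<noteq> y"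
  using assms by (metis card_2_iff simple_edges_def)

lemma not_mem_nbrs: "simple_edges E \<Longrightarrow> v \<notin> nbrs E v"
  by (auto simp: nbrs_def simple_edges_def)

lemma finite_Union_edges: "simple_edges E \<Longrightarrow> finite (\<Union>E)"
  unfolding simple_edges_def by (intro finite_Union) (auto intro: card_ge_0_finite)

lemma nbrs_subset_Union: "nbrs E v \<subseteq> \<Union>E"
  by (auto simp: nbrs_def)

lemma finite_nbrs: "simple_edges E \<Longrightarrow> finite (nbrs E v)"
  using finite_Union_edges nbrs_subset_Union finite_subset by metis

lemma edges_at_eq_star:
  assumes "simple_edges E"
  shows "{e \<in> E. v \<in> e} = star v (nbrs E v)"
proof
  show "{e \<in> E. v \<in> e} \<subseteq> star v (nbrs E v)"
  proof
    fix e assume "e \<in> {e \<in> E. v \<in> e}"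
    then obtain x y where "e = {x, y}" "x \<noteq> y" "v \<in> e" "e \<in> E" using edge_cases assms by blast
    then show "e \<in> star v (nbrs E v)" by (auto simp: star_def nbrs_def insert_commute)
  qed
qed (auto simp: star_def nbrs_def)

lemma card_edges_at: "simple_edges E \<Longrightarrow> card {e \<in> E. v \<in> e} = card (nbrs E v)"
  by (simp add: edges_at_eq_star card_star not_mem_nbrs)

lemma complete_on_subset: "complete_on E S \<Longrightarrow> T \<subseteq> S \<Longrightarrow> complete_on E T"
  by (auto simp: complete_on_def)

lemma exists_other_element:
  assumes "2 \<le> card S"
  shows "\<exists>v\<in>S. v \<noteq> u"
proof (rule ccontr)
  assume "\<not> ?thesis"
  then have "S \<subseteq> {u}" by blast
  then have "card S \<le> card {u}" by (intro card_mono) auto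
  with assms show False by simp
qed

lemma clique_has_edge_at:
  assumes "S \<in> cliques E" "u \<in> S"
  shows "\<exists>v\<in>S. v \<noteq> u \<and> {u, v} \<in> E"
proof -
  obtain v where "v \<in> S" "v \<noteq> u" using exists_other_element[of S u] assms by (auto simp: cliques_def)
  then show ?thesis using assms by (force simp: cliques_def complete_on_def)
qed

lemma clique_subset_Union:
  assumes "S \<in> cliques E"
  shows "S \<subseteq> \<Union>E"
proof
  fix u assume "u \<in> S"
  then obtain v where "{u, v} \<in> E" using clique_has_edge_at[OF assms] by blast
  then show "u \<in> \<Union>E" by blast
qed

lemma finite_cliques: "simple_edges E \<Longrightarrow> finite (cliques E)"
  using finite_Union_edges clique_subset_Union by (metis PowI finite_Pow_iff finite_subset subsetI)

lemma cliques_mono: "E \<subseteq> F \<Longrightarrow> cliques E \<subseteq> cliques F"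
  by (auto simp: cliques_def complete_on_def)

lemma cliques_avoiding: "cliques (avoiding E A) = {S \<in> cliques E. S \<inter> A = {}}"
proof
  show "cliques (avoiding E A) \<subseteq> {S \<in> cliques E. S \<inter> A = {}}"
    using cliques_mono[of "avoiding E A" E] clique_subset_Union[of _ "avoiding E A"]
    by (fastforce simp: avoiding_def)
  show "{S \<in> cliques E. S \<inter> A = {}} \<subseteq> cliques (avoiding E A)"
    by (auto simp: cliques_def complete_on_def avoiding_def)
qed

lemma clique_count_avoiding:
  assumes "simple_edges E"
  shows "clique_count E = clique_count (avoiding E A) + card {S \<in> cliques E. S \<inter> A \<noteq> {}}"
proof -
  have "card ({S \<in> cliques E. S \<inter> A = {}} \<union> {S \<in> cliques E. S \<inter> A \<noteq> {}}) =
    card {S \<in> cliques E. S \<inter> A = {}} + card {S \<in> cliques E. S \<inter> A \<noteq> {}}"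
    using finite_cliques[OF assms] by (intro card_Un_disjoint) auto
  moreover have "{S \<in> cliques E. S \<inter> A = {}} \<union> {S \<in> cliques E. S \<inter> A \<noteq> {}} = cliques E" by auto
  ultimately show ?thesis by (simp add: clique_count_def cliques_avoiding)
qed

lemma card_avoiding:
  assumes "simple_edges E"
  shows "card E = card (avoiding E A) + card {e \<in> E. e \<inter> A \<noteq> {}}"
proof -
  have "card (avoiding E A \<union> {e \<in> E. e \<inter> A \<noteq> {}}) =
    card (avoiding E A) + card {e \<in> E. e \<inter> A \<noteq> {}}"
    using assms by (intro card_Un_disjoint) (auto simp: avoiding_def simple_edges_def)
  moreover have "avoiding E A \<union> {e \<in> E. e \<inter> A \<noteq> {}} = E" by (auto simp: avoiding_def)
  ultimately show ?thesis by simp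
qed

lemma inj_on_insert: "inj_on (insert v) {S. v \<notin> S}"
  unfolding inj_on_def by (metis Diff_insert_absorb mem_Collect_eq)

lemma cliques_at:
  assumes "simple_edges E"
  shows "{S \<in> cliques E. v \<in> S} = insert v ` {T. T \<subseteq> nbrs E v \<and> T \<noteq> {} \<and> complete_on E T}"
proof (intro equalityI subsetI)
  fix S assume "S \<in> {S \<in> cliques E. v \<in> S}"
  then have S: "S \<in> cliques E" "v \<in> S" by auto
  then have "S = insert v (S - {v})" by auto
  moreover have "S - {v} \<subseteq> nbrs E v" using S by (auto simp: cliques_def complete_on_def nbrs_def)
  moreover have "S - {v} \<noteq> {}" using clique_has_edge_at[OF S] by blast
  moreover have "complete_on E (S - {v})" using S by (auto simp: cliques_def complete_on_def)
  ultimately show "S \<in> insert v ` {T. T \<subseteq> nbrs E v \<and> T \<noteq> {} \<and> complete_on E T}" by blast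
next
  fix S assume "S \<in> insert v ` {T. T \<subseteq> nbrs E v \<and> T \<noteq> {} \<and> complete_on E T}"
  then obtain T where T: "S = insert v T" "T \<subseteq> nbrs E v" "T \<noteq> {}" "complete_on E T" by blast
  have fin: "finite T" using T finite_nbrs[OF assms] finite_subset by blast
  moreover have "v \<notin> T" using T not_mem_nbrs[OF assms] by blast
  moreover have "card T > 0" using fin T by (simp add: card_gt_0_iff)
  ultimately show "S \<in> {S \<in> cliques E. v \<in> S}"
    using T by (auto simp: cliques_def complete_on_def nbrs_def insert_commute)
qed

text \<open>Cliques through \<open>v\<close> correspond to nonempty complete subsets of its
  neighbourhood, and all nonempty subsets occur exactly if the neighbourhood itself is complete. The
  condition is written as an intersection with \<open>{v}\<close> to fit
  \<open>clique_count_avoiding\<close>.\<close>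

lemma card_cliques_at:
  assumes "simple_edges E"
  shows "card {S \<in> cliques E. S \<inter> {v} \<noteq> {}} \<le> 2 ^ card (nbrs E v) - 1"
    and "card {S \<in> cliques E. S \<inter> {v} \<noteq> {}} = 2 ^ card (nbrs E v) - 1 \<longleftrightarrow> complete_on E (nbrs E v)"
proof -
  let ?N = "nbrs E v" and ?T = "{T. T \<subseteq> nbrs E v \<and> T \<noteq> {} \<and> complete_on E T}"
  have fin: "finite ?N" using assms by (rule finite_nbrs)
  have "?T \<subseteq> {S. v \<notin> S}" using not_mem_nbrs[OF assms] by blast
  then have "inj_on (insert v) ?T" by (rule inj_on_subset[OF inj_on_insert])
  moreover have "{S \<in> cliques E. S \<inter> {v} \<noteq> {}} = {S \<in> cliques E. v \<in> S}" by auto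
  ultimately have eq: "card {S \<in> cliques E. S \<inter> {v} \<noteq> {}} = card ?T"
    by (simp add: cliques_at[OF assms] card_image)
  have card: "card (Pow ?N - {{}}) = 2 ^ card ?N - 1"
    using fin by (simp add: card_Pow card_Diff_subset)
  have sub: "?T \<subseteq> Pow ?N - {{}}" by auto
  show "card {S \<in> cliques E. S \<inter> {v} \<noteq> {}} \<le> 2 ^ card ?N - 1"
    using card_mono[OF _ sub] fin eq card by simp
  show "card {S \<in> cliques E. S \<inter> {v} \<noteq> {}} = 2 ^ card ?N - 1 \<longleftrightarrow> complete_on E ?N"
  proof
    assume "card {S \<in> cliques E. S \<inter> {v} \<noteq> {}} = 2 ^ card ?N - 1"
    then have "?T = Pow ?N - {{}}" using card_subset_eq[OF _ sub] fin eq card by simp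
    then show "complete_on E ?N" by (cases "?N = {}") (auto simp: complete_on_def[of _ "{}"])
  next
    assume "complete_on E ?N"
    then have "?T = Pow ?N - {{}}" using complete_on_subset by auto
    then show "card {S \<in> cliques E. S \<inter> {v} \<noteq> {}} = 2 ^ card ?N - 1" using eq card by simp
  qed
qed

lemma card_2_cliques:
  assumes "simple_edges E"
  shows "{S \<in> cliques E. card S = 2} = E"
proof (intro equalityI subsetI)
  fix S assume S: "S \<in> {S \<in> cliques E. card S = 2}"
  then obtain x y where "S = {x, y}" "x \<noteq> y" by (auto simp: card_2_iff)
  then show "S \<in> E" using S by (simp add: cliques_def complete_on_def)
next
  fix e assume e: "e \<in> E"
  then obtain x y where "e = {x, y}" "x \<noteq> y" using edge_cases assms by blast
  then show "e \<in> {S \<in> cliques E. card S = 2}"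
    using e by (simp add: cliques_def complete_on_def insert_commute)
qed

section \<open>Double counting of cliques that touch a neighbourhood\<close>

definition touching_cliques :: "'a set set \<Rightarrow> 'a \<Rightarrow> 'a set set" where
  "touching_cliques E v = {S \<in> cliques E. 3 \<le> card S \<and> v \<notin> S \<and> S \<inter> nbrs E v \<noteq> {}}"

text \<open>The three terms are the edges, the larger cliques through \<open>v\<close>, which become
  cliques among the neighbours when \<open>v\<close> is removed, and the larger cliques avoiding
  \<open>v\<close>.\<close>

lemma card_cliques_meeting_neighbourhood:
  assumes "simple_edges E"
  defines "A \<equiv> \<lambda>v. insert v (nbrs E v)"
  shows "card {S \<in> cliques E. S \<inter> A v \<noteq> {}} =
    card {e \<in> E. e \<inter> A v \<noteq> {}} + clique_count (induced E (nbrs E v)) + card (touching_cliques E v)"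
proof -
  let ?C = "{S \<in> cliques E. 3 \<le> card S \<and> v \<in> S}"
  have fin: "finite (cliques E)" using assms(1) by (rule finite_cliques)
  have C: "?C = insert v ` cliques (induced E (nbrs E v))"
  proof (intro equalityI subsetI)
    fix S assume S: "S \<in> ?C"
    then have "S = insert v (S - {v})" by auto
    moreover have "S - {v} \<in> cliques (induced E (nbrs E v))"
      using S by (auto simp: cliques_def complete_on_def induced_def nbrs_def)
    ultimately show "S \<in> insert v ` cliques (induced E (nbrs E v))" by blast
  next
    fix S assume "S \<in> insert v ` cliques (induced E (nbrs E v))"
    then obtain T where T: "S = insert v T" "T \<in> cliques (induced E (nbrs E v))" by blast
    then have sub: "T \<subseteq> nbrs E v" using clique_subset_Union by (fastforce simp: induced_def)
    then have "v \<notin> T" using not_mem_nbrs[OF assms(1)] by blast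
    with T sub show "S \<in> ?C"
      by (auto simp: cliques_def complete_on_def induced_def nbrs_def insert_commute)
  qed
  have "cliques (induced E (nbrs E v)) \<subseteq> {S. v \<notin> S}"
    using clique_subset_Union not_mem_nbrs[OF assms(1)] by (fastforce simp: induced_def)
  then have "inj_on (insert v) (cliques (induced E (nbrs E v)))" by (rule inj_on_subset[OF inj_on_insert])
  then have cardC: "card ?C = clique_count (induced E (nbrs E v))"
    by (simp add: C card_image clique_count_def)
  have D: "{e \<in> E. e \<inter> A v \<noteq> {}} = {S \<in> cliques E. card S = 2 \<and> S \<inter> A v \<noteq> {}}"
    using card_2_cliques[OF assms(1)] by blast
  have "{S \<in> cliques E. S \<inter> A v \<noteq> {}} =
    {S \<in> cliques E. card S = 2 \<and> S \<inter> A v \<noteq> {}} \<union> (?C \<union> touching_cliques E v)"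
    by (auto simp: touching_cliques_def A_def) (auto simp: cliques_def)
  also have "card \<dots> = card {S \<in> cliques E. card S = 2 \<and> S \<inter> A v \<noteq> {}} + card (?C \<union> touching_cliques E v)"
    by (intro card_Un_disjoint) (use fin in \<open>auto simp: touching_cliques_def\<close>)
  also have "card (?C \<union> touching_cliques E v) = card ?C + card (touching_cliques E v)"
    by (intro card_Un_disjoint) (use fin in \<open>auto simp: touching_cliques_def\<close>)
  finally show ?thesis using D cardC by simp
qed

text \<open>The double count of Chase: for a fixed vertex set \<open>Q\<close>, the vertices whose deletion from \<open>Q\<close>
  leaves a clique touching them are at most as many as the vertices adjacent to all of \<open>Q\<close>. If there
  are two of the former then \<open>Q\<close> lacks at most the edge between them.\<close>

lemma sum_touching_cliques_le:
  assumes "simple_edges E"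
  shows "(\<Sum>v\<in>\<Union>E. card (touching_cliques E v)) \<le> (\<Sum>v\<in>\<Union>E. card {T. T \<subseteq> nbrs E v \<and> 3 \<le> card T})"
proof -
  let ?V = "\<Union>E"
  \<comment> \<open>The set \<open>Q\<close> encodes \<open>v\<close> together with
    \<open>Q - {v}\<close>; the number 4 is size 3 plus \<open>v\<close>.\<close>
  define P where "P v Q \<longleftrightarrow> v \<in> Q \<and> 4 \<le> card Q \<and> complete_on E (Q - {v}) \<and> (Q - {v}) \<inter> nbrs E v \<noteq> {}"
    for v Q
  define R where "R v Q \<longleftrightarrow> v \<in> Q \<and> 4 \<le> card Q \<and> Q - {v} \<subseteq> nbrs E v" for v Q
  have fin: "finite ?V" using assms by (rule finite_Union_edges)
  have P: "card (touching_cliques E v) = card {Q \<in> Pow ?V. P v Q}" if "v \<in> ?V" for v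
  proof -
    have "{Q \<in> Pow ?V. P v Q} = insert v ` touching_cliques E v"
    proof (intro equalityI subsetI)
      fix Q assume Q: "Q \<in> {Q \<in> Pow ?V. P v Q}"
      then have "finite Q" using fin finite_subset by auto
      with Q have "Q - {v} \<in> touching_cliques E v"
        by (auto simp: P_def touching_cliques_def cliques_def)
      moreover have "Q = insert v (Q - {v})" using Q by (auto simp: P_def)
      ultimately show "Q \<in> insert v ` touching_cliques E v" by blast
    next
      fix Q assume "Q \<in> insert v ` touching_cliques E v"
      then obtain S where S: "Q = insert v S" "S \<in> touching_cliques E v" by blast
      moreover have "S \<subseteq> ?V" using S clique_subset_Union by (auto simp: touching_cliques_def)
      ultimately show "Q \<in> {Q \<in> Pow ?V. P v Q}"
        using that by (auto simp: P_def touching_cliques_def cliques_def)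
    qed
    moreover have "inj_on (insert v) (touching_cliques E v)"
      by (rule inj_on_subset[OF inj_on_insert]) (auto simp: touching_cliques_def)
    ultimately show ?thesis by (simp add: card_image)
  qed
  have R: "card {T. T \<subseteq> nbrs E v \<and> 3 \<le> card T} = card {Q \<in> Pow ?V. R v Q}" if "v \<in> ?V" for v
  proof -
    have "{Q \<in> Pow ?V. R v Q} = insert v ` {T. T \<subseteq> nbrs E v \<and> 3 \<le> card T}"
    proof (intro equalityI subsetI)
      fix Q assume Q: "Q \<in> {Q \<in> Pow ?V. R v Q}"
      then have "finite Q" using fin finite_subset by auto
      with Q have "Q - {v} \<in> {T. T \<subseteq> nbrs E v \<and> 3 \<le> card T}"
        by (auto simp: R_def)
      moreover have "Q = insert v (Q - {v})" using Q by (auto simp: R_def)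
      ultimately show "Q \<in> insert v ` {T. T \<subseteq> nbrs E v \<and> 3 \<le> card T}" by blast
    next
      fix Q assume "Q \<in> insert v ` {T. T \<subseteq> nbrs E v \<and> 3 \<le> card T}"
      then obtain T where T: "Q = insert v T" "T \<subseteq> nbrs E v" "3 \<le> card T" by blast
      moreover have "v \<notin> T" using T not_mem_nbrs[OF assms] by blast
      moreover have "finite T" using T finite_nbrs[OF assms] finite_subset by blast
      ultimately show "Q \<in> {Q \<in> Pow ?V. R v Q}"
        using that nbrs_subset_Union[of E v] by (auto simp: R_def)
    qed
    moreover have "inj_on (insert v) {T. T \<subseteq> nbrs E v \<and> 3 \<le> card T}"
      by (rule inj_on_subset[OF inj_on_insert]) (use not_mem_nbrs[OF assms] in blast)
    ultimately show ?thesis by (simp add: card_image)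
  qed
  have PR: "card {v \<in> ?V. P v Q} \<le> card {v \<in> ?V. R v Q}" if "Q \<in> Pow ?V" for Q
  proof (cases "\<exists>v. P v Q")
    case False
    then have "{v \<in> ?V. P v Q} = {}" by blast
    then show ?thesis by (metis card.empty le0)
  next
    case True
    then obtain v where v: "P v Q" by blast
    have QV: "Q \<subseteq> ?V" and finQ: "finite Q" using that fin finite_subset by auto
    have finR: "finite {v \<in> ?V. R v Q}" using fin by (rule rev_finite_subset) auto
    show ?thesis
    proof (cases "{v \<in> ?V. P v Q} \<subseteq> {v}")
      case True
      \<comment> \<open>The clique \<open>Q - {v}\<close> contains a neighbour \<open>u\<close> of
        \<open>v\<close>. It is adjacent to the rest of the clique as well, so \<open>u\<close>
        matches the single vertex on the left.\<close>
      from v obtain u where u: "u \<in> Q" "u \<noteq> v" "u \<in> nbrs E v" by (auto simp: P_def)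
      then have "R u Q" using v by (auto simp: R_def P_def complete_on_def nbrs_def insert_commute)
      then have "{u} \<subseteq> {v \<in> ?V. R v Q}" using u QV by auto
      then have "card {u} \<le> card {v \<in> ?V. R v Q}" using finR card_mono by blast
      moreover have "card {v \<in> ?V. P v Q} \<le> card {v}" using True by (intro card_mono) auto
      ultimately show ?thesis by simp
    next
      case False
      then obtain v' where v': "P v' Q" "v' \<noteq> v" by blast
      \<comment> \<open>A pair other than \<open>{v, v'}\<close> misses \<open>v\<close> or
        \<open>v'\<close> and so lies in one of the two cliques \<open>Q - {v}\<close> and
        \<open>Q - {v'}\<close>.\<close>
      have all: "{x, y} \<in> E" if "x \<in> Q" "y \<in> Q" "x \<noteq> y" "{x, y} \<noteq> {v, v'}" for x y
      proof (cases "x = v \<or> y = v")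
        case True
        then have "x \<noteq> v'" "y \<noteq> v'" using that v' by auto
        then show ?thesis using that v' by (auto simp: P_def complete_on_def)
      next
        case False
        then show ?thesis using that v by (auto simp: P_def complete_on_def)
      qed
      show ?thesis
      proof (cases "{v, v'} \<in> E")
        case True
        then have "{v \<in> ?V. P v Q} \<subseteq> {v \<in> ?V. R v Q}"
          using all by (auto simp: P_def R_def nbrs_def) metis
        then show ?thesis using finR card_mono by blast
      next
        case False
        \<comment> \<open>Deleting any third vertex keeps the nonadjacent pair, so at most two
          vertices count on the left. All other vertices of \<open>Q\<close> count on the right, and
          \<open>4 \<le> card Q\<close> provides two of them.\<close>
        have "{v \<in> ?V. P v Q} \<subseteq> {v, v'}"
          using False v v' by (auto simp: P_def complete_on_def)
        then have "card {v \<in> ?V. P v Q} \<le> card {v, v'}" by (intro card_mono) auto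
        also have "\<dots> \<le> card (Q - {v, v'})"
          using v v' finQ by (auto simp: P_def card_Diff_subset)
        also have "\<dots> \<le> card {v \<in> ?V. R v Q}"
          using finR all QV v by (intro card_mono) (auto simp: P_def R_def nbrs_def doubleton_eq_iff)
        finally show ?thesis .
      qed
    qed
  qed
  have "(\<Sum>v\<in>?V. card (touching_cliques E v)) = (\<Sum>v\<in>?V. card {Q \<in> Pow ?V. P v Q})"
    using P by (intro sum.cong) auto
  also have "\<dots> = (\<Sum>Q\<in>Pow ?V. card {v \<in> ?V. P v Q})"
    using fin by (intro sum_multicount_gen) auto
  also have "\<dots> \<le> (\<Sum>Q\<in>Pow ?V. card {v \<in> ?V. R v Q})"
    using PR by (intro sum_mono) auto
  also have "\<dots> = (\<Sum>v\<in>?V. card {Q \<in> Pow ?V. R v Q})"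
    using fin by (intro sum_multicount_gen[symmetric]) auto
  also have "\<dots> = (\<Sum>v\<in>?V. card {T. T \<subseteq> nbrs E v \<and> 3 \<le> card T})"
    using R by (intro sum.cong) auto
  finally show ?thesis .
qed

lemma exists_few_touching_cliques:
  assumes "simple_edges E" "E \<noteq> {}"
  shows "\<exists>v\<in>\<Union>E. card (touching_cliques E v) \<le> card {T. T \<subseteq> nbrs E v \<and> 3 \<le> card T}"
proof (rule ccontr)
  assume "\<not> ?thesis"
  then have *: "card {T. T \<subseteq> nbrs E v \<and> 3 \<le> card T} < card (touching_cliques E v)" if "v \<in> \<Union>E" for v
    using that by force
  have "\<Union>E \<noteq> {}" using assms by (force simp: simple_edges_def)
  then have "(\<Sum>v\<in>\<Union>E. card {T. T \<subseteq> nbrs E v \<and> 3 \<le> card T}) < (\<Sum>v\<in>\<Union>E. card (touching_cliques E v))"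
    using * finite_Union_edges[OF assms(1)] by (intro sum_strict_mono)
  with sum_touching_cliques_le[OF assms(1)] show False by simp
qed

lemma card_subsets_ge_2:
  assumes "finite X"
  shows "int (card {T. T \<subseteq> X \<and> 2 \<le> card T}) = 2 ^ card X - int (card X) - 1"
proof -
  let ?P = "\<lambda>k. {T. T \<subseteq> X \<and> card T = k}"
  have "Pow X = {T. T \<subseteq> X \<and> 2 \<le> card T} \<union> (?P 0 \<union> ?P 1)" by auto
  then have "card (Pow X) = card ({T. T \<subseteq> X \<and> 2 \<le> card T} \<union> (?P 0 \<union> ?P 1))" by simp
  also have "\<dots> = card {T. T \<subseteq> X \<and> 2 \<le> card T} + card (?P 0 \<union> ?P 1)"
    using assms by (intro card_Un_disjoint) auto
  also have "card (?P 0 \<union> ?P 1) = card (?P 0) + card (?P 1)"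
    using assms by (intro card_Un_disjoint) auto
  finally have "2 ^ card X = card {T. T \<subseteq> X \<and> 2 \<le> card T} + (1 + card X)"
    using assms n_subsets[of X 0] n_subsets[of X 1] by (simp add: card_Pow)
  then have "int (2 ^ card X) = int (card {T. T \<subseteq> X \<and> 2 \<le> card T} + (1 + card X))" by presburger
  then show ?thesis by simp
qed

text \<open>These subsets are the cliques of a complete graph other than its edges. In this form the
  touching cliques enter \<open>colex_kappa_remove_neighbourhood\<close>.\<close>

lemma card_subsets_ge_3:
  assumes "finite X"
  shows "int (card {T. T \<subseteq> X \<and> 3 \<le> card T}) = colex_kappa (card X choose 2) - int (card X choose 2)"
proof -
  have "{T. T \<subseteq> X \<and> 2 \<le> card T} = {T. T \<subseteq> X \<and> 3 \<le> card T} \<union> {T. T \<subseteq> X \<and> card T = 2}" by auto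
  then have "card {T. T \<subseteq> X \<and> 2 \<le> card T} = card ({T. T \<subseteq> X \<and> 3 \<le> card T} \<union> {T. T \<subseteq> X \<and> card T = 2})"
    by simp
  also have "\<dots> = card {T. T \<subseteq> X \<and> 3 \<le> card T} + card {T. T \<subseteq> X \<and> card T = 2}"
    using assms by (intro card_Un_disjoint) auto
  finally show ?thesis
    using card_subsets_ge_2[OF assms] assms by (simp add: n_subsets colex_kappa_choose_two)
qed

text \<open>An edge has at most two ends in \<open>A\<close>. For a closed neighbourhood this turns
  minimum degree into a lower bound on the number of deleted edges.\<close>

lemma sum_degrees_le:
  assumes "simple_edges E" "finite A"
  shows "(\<Sum>u\<in>A. card (nbrs E u)) \<le> 2 * card {e \<in> E. e \<inter> A \<noteq> {}}"
proof -
  let ?F = "{e \<in> E. e \<inter> A \<noteq> {}}"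
  have fin: "finite ?F" using assms by (simp add: simple_edges_def)
  have "(\<Sum>u\<in>A. card (nbrs E u)) = (\<Sum>u\<in>A. card {e \<in> ?F. u \<in> e})"
  proof (rule sum.cong)
    fix u assume "u \<in> A"
    then have "{e \<in> ?F. u \<in> e} = {e \<in> E. u \<in> e}" by auto
    then show "card (nbrs E u) = card {e \<in> ?F. u \<in> e}" using card_edges_at[OF assms(1)] by simp
  qed simp
  also have "\<dots> = (\<Sum>e\<in>?F. card {u \<in> A. u \<in> e})"
    using fin assms by (intro sum_multicount_gen) auto
  also have "\<dots> \<le> (\<Sum>e\<in>?F. 2)"
  proof (rule sum_mono)
    fix e assume "e \<in> ?F"
    then have e: "card e = 2" using assms by (auto simp: simple_edges_def)
    then have "card {u \<in> A. u \<in> e} \<le> card e" by (intro card_mono) (auto intro: card_ge_0_finite)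
    with e show "card {u \<in> A. u \<in> e} \<le> 2" by simp
  qed
  finally show ?thesis by simp
qed

lemma degree_plus_card_induced_le:
  assumes "simple_edges E"
  shows "card (nbrs E v) + card (induced E (nbrs E v)) \<le> card {e \<in> E. e \<inter> insert v (nbrs E v) \<noteq> {}}"
proof -
  have v: "v \<notin> nbrs E v" using assms by (rule not_mem_nbrs)
  have ne: "e \<noteq> {}" if "e \<in> E" for e using assms that by (auto simp: simple_edges_def)
  have "card (nbrs E v) + card (induced E (nbrs E v)) = card (star v (nbrs E v)) + card (induced E (nbrs E v))"
    using v by (simp add: card_star)
  also have "\<dots> = card (star v (nbrs E v) \<union> induced E (nbrs E v))"
    using assms v finite_nbrs[OF assms, of v]
    by (intro card_Un_disjoint[symmetric]) (auto simp: star_def induced_def simple_edges_def)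
  also have "\<dots> \<le> card {e \<in> E. e \<inter> insert v (nbrs E v) \<noteq> {}}"
    using assms ne by (intro card_mono) (auto simp: star_def induced_def simple_edges_def nbrs_def)
  finally show ?thesis .
qed

section \<open>Complete graphs and disjoint unions\<close>

lemma cliques_pairs:
  assumes "finite X"
  shows "cliques (pairs X) = {S. S \<subseteq> X \<and> 2 \<le> card S}"
proof (intro equalityI subsetI)
  fix S assume S: "S \<in> cliques (pairs X)"
  then show "S \<in> {S. S \<subseteq> X \<and> 2 \<le> card S}"
    using clique_subset_Union[OF S] by (auto simp: pairs_def cliques_def)
next
  fix S assume S: "S \<in> {S. S \<subseteq> X \<and> 2 \<le> card S}"
  then have "finite S" using assms finite_subset by blast
  then show "S \<in> cliques (pairs X)" using S by (auto simp: cliques_def complete_on_def)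
qed

lemma clique_count_pairs:
  "finite X \<Longrightarrow> int (clique_count (pairs X)) = colex_kappa (card X choose 2)"
  by (simp add: clique_count_def cliques_pairs card_subsets_ge_2 colex_kappa_choose_two)

text \<open>One vertex of a clique decides the side: its edges to the other vertices of the clique
  must lie there, hence so do these vertices and all edges between them.\<close>

lemma cliques_disjoint_Un:
  assumes "\<Union>E \<inter> \<Union>F = {}"
  shows "cliques (E \<union> F) = cliques E \<union> cliques F"
proof (intro equalityI subsetI)
  fix S assume S: "S \<in> cliques (E \<union> F)"
  then have "S \<noteq> {}" by (auto simp: cliques_def)
  then obtain u where u: "u \<in> S" by blast
  have pair: "{x, y} \<in> E \<union> F" if "x \<in> S" "y \<in> S" "x \<noteq> y" for x y
    using S that unfolding cliques_def complete_on_def by blast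
  from clique_has_edge_at[OF S u] obtain v where v: "v \<in> S" "v \<noteq> u" "{u, v} \<in> E \<union> F" by blast
  have "complete_on E S" if "u \<in> \<Union>E"
    unfolding complete_on_def
  proof (intro ballI impI)
    fix x y assume xy: "x \<in> S" "y \<in> S" "x \<noteq> y"
    have "x \<in> \<Union>E"
    proof (cases "x = u")
      case False
      then have "{u, x} \<in> E \<union> F" using pair u xy by metis
      moreover have "{u, x} \<notin> F" using that assms by blast
      ultimately show ?thesis by blast
    qed (use that in simp)
    then have "{x, y} \<notin> F" using assms by blast
    then show "{x, y} \<in> E" using pair[OF xy] by blast
  qed
  moreover have "complete_on F S" if "u \<in> \<Union>F"
    unfolding complete_on_def
  proof (intro ballI impI)
    fix x y assume xy: "x \<in> S" "y \<in> S" "x \<noteq> y"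
    have "x \<in> \<Union>F"
    proof (cases "x = u")
      case False
      then have "{u, x} \<in> E \<union> F" using pair u xy by metis
      moreover have "{u, x} \<notin> E" using that assms by blast
      ultimately show ?thesis by blast
    qed (use that in simp)
    then have "{x, y} \<notin> E" using assms by blast
    then show "{x, y} \<in> F" using pair[OF xy] by blast
  qed
  moreover have "u \<in> \<Union>E \<or> u \<in> \<Union>F" using v by blast
  ultimately have "complete_on E S \<or> complete_on F S" by metis
  then show "S \<in> cliques E \<union> cliques F" using S by (auto simp: cliques_def)
next
  fix S assume "S \<in> cliques E \<union> cliques F"
  then show "S \<in> cliques (E \<union> F)" using cliques_mono[of E "E \<union> F"] cliques_mono[of F "E \<union> F"] by blast
qed

lemma clique_count_disjoint_Un:
  assumes "simple_edges E" "simple_edges F" "\<Union>E \<inter> \<Union>F = {}"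
  shows "clique_count (E \<union> F) = clique_count E + clique_count F"
proof -
  have "cliques E \<inter> cliques F = {}"
  proof (rule ccontr)
    assume "cliques E \<inter> cliques F \<noteq> {}"
    then obtain S where "S \<in> cliques E" "S \<in> cliques F" by blast
    then have "S \<subseteq> \<Union>E \<inter> \<Union>F" "S \<noteq> {}" using clique_subset_Union by (auto simp: cliques_def)
    then show False using assms by simp
  qed
  then show ?thesis
    using assms by (simp add: clique_count_def cliques_disjoint_Un card_Un_disjoint finite_cliques)
qed

section \<open>The bound and its extremal edge sets\<close>

text \<open>The vertex \<open>w\<close> is arbitrary if \<open>D\<close> is empty: the vertex type need not have an element outside \<open>X\<close>.\<close>

definition colex_shape :: "nat \<Rightarrow> nat \<Rightarrow> 'a set set \<Rightarrow> bool" where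
  "colex_shape c j E \<longleftrightarrow> (\<exists>X w D. finite X \<and> card X = c \<and> D \<subseteq> X \<and> card D = j \<and>
     (D \<noteq> {} \<longrightarrow> w \<notin> X) \<and> E = pairs X \<union> star w D)"

definition clique_plus_edge :: "nat \<Rightarrow> 'a set set \<Rightarrow> bool" where
  "clique_plus_edge c E \<longleftrightarrow> (\<exists>X x y. finite X \<and> card X = c \<and> x \<notin> X \<and> y \<notin> X \<and> x \<noteq> y \<and>
     E = pairs X \<union> {{x, y}})"

text \<open>For \<open>c \<ge> 2\<close> a last row of length 1 contributes a single clique, its
  edge, so detaching that edge from \<open>K_c\<close> costs nothing. For \<open>c = 1\<close> the
  detached edge would be the whole graph, which is already a colex shape.\<close>

definition extremal_remainder :: "nat \<Rightarrow> 'a set set \<Rightarrow> bool" where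
  "extremal_remainder b E \<longleftrightarrow> (\<exists>c j. j < c \<and> b = (c choose 2) + j \<and> colex_shape c j E) \<or>
     (\<exists>c. 2 \<le> c \<and> b = (c choose 2) + 1 \<and> clique_plus_edge c E)"

text \<open>The predicate on the remainder is a parameter, so that statements about remainders alone
  (attaching a vertex, counting, isomorphism) lift through the \<open>a\<close> components by
  induction.\<close>

primrec with_cliques :: "nat \<Rightarrow> ('a set set \<Rightarrow> bool) \<Rightarrow> nat \<Rightarrow> 'a set set \<Rightarrow> bool" where
  "with_cliques n P 0 E \<longleftrightarrow> P E"
| "with_cliques n P (Suc a) E \<longleftrightarrow> (\<exists>Y F. finite Y \<and> card Y = n \<and> Y \<inter> \<Union>F = {} \<and> E = F \<union> pairs Y \<and>
     with_cliques n P a F)"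

lemma star_empty [simp]: "star w {} = {}"
  by (simp add: star_def)

lemma Union_star: "D \<noteq> {} \<Longrightarrow> \<Union>(star w D) = insert w D"
  by (auto simp: star_def)

lemma Union_pairs: "2 \<le> card X \<Longrightarrow> \<Union>(pairs X) = X"
proof (intro equalityI subsetI)
  fix x assume "2 \<le> card X" "x \<in> X"
  then obtain y where "y \<in> X" "y \<noteq> x" using exists_other_element[of X x] by blast
  with \<open>x \<in> X\<close> have "{x, y} \<in> pairs X" by simp
  then show "x \<in> \<Union>(pairs X)" by blast
qed (auto simp: pairs_def)

lemma Union_pairs_subset: "\<Union>(pairs X) \<subseteq> X"
  by (auto simp: pairs_def)

lemma pairs_insert: "v \<notin> X \<Longrightarrow> pairs (insert v X) = pairs X \<union> star v X"
proof (intro equalityI subsetI)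
  fix e assume "v \<notin> X" "e \<in> pairs (insert v X)"
  then obtain x y where "e = {x, y}" "x \<noteq> y" "e \<subseteq> insert v X" by (auto simp: pairs_def card_2_iff)
  then show "e \<in> pairs X \<union> star v X" by (auto simp: star_def)
next
  fix e assume "v \<notin> X" "e \<in> pairs X \<union> star v X"
  then show "e \<in> pairs (insert v X)" by (auto simp: star_def) (auto simp: pairs_def)
qed

lemma pairs_doubleton: "x \<noteq> y \<Longrightarrow> pairs {x, y} = {{x, y}}"
  by (auto simp: pairs_def card_2_iff doubleton_eq_iff)

lemma complete_on_subset_Union: "complete_on E N \<Longrightarrow> 2 \<le> card N \<Longrightarrow> N \<subseteq> \<Union>E"
  by (rule clique_subset_Union) (auto simp: cliques_def intro: card_ge_0_finite)

section \<open>Adding a vertex to an extremal remainder\<close>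

lemma extremal_remainder_cases:
  assumes "extremal_remainder ((c choose 2) + j) E" "j < c"
  shows "colex_shape c j E \<or> j = 1 \<and> 2 \<le> c \<and> clique_plus_edge c E"
  using assms(1) unfolding extremal_remainder_def
proof
  assume "\<exists>c' j'. j' < c' \<and> (c choose 2) + j = (c' choose 2) + j' \<and> colex_shape c' j' E"
  then show ?thesis using colex_representation_unique[OF _ assms(2)] by metis
next
  assume "\<exists>c'\<ge>2. (c choose 2) + j = (c' choose 2) + 1 \<and> clique_plus_edge c' E"
  then show ?thesis using colex_representation_unique[OF _ assms(2)]
    by (metis One_nat_def Suc_1 Suc_le_lessD)
qed

text \<open>Here \<open>H\<close> is a clique on some \<open>X\<close>. A complete \<open>N\<close>
  with two or more vertices lies inside \<open>X\<close>, but a single neighbour may be isolated in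
  \<open>H\<close>; this is how \<open>K_c\<close> with a separate edge arises.\<close>

lemma extremal_remainder_attach_to_clique:
  assumes H: "extremal_remainder (c choose 2) H" and v: "v \<notin> \<Union>H" "v \<notin> N"
    and N: "complete_on H N" "card N = j" "0 < j" "j < c"
  shows "extremal_remainder ((c choose 2) + j) (H \<union> star v N)"
proof -
  have "colex_shape c 0 H" using extremal_remainder_cases[of c 0 H] H N by simp
  then obtain X where X: "finite X" "card X = c" "H = pairs X"
    unfolding colex_shape_def
    by (metis card_eq_0_iff finite_subset star_empty sup_bot_right)
  have UX: "\<Union>H = X" using X N by (simp add: Union_pairs)
  then have vX: "v \<notin> X" using v by simp
  show ?thesis
  proof (cases "N \<subseteq> X")
    case True
    then have "colex_shape c j (H \<union> star v N)"
      unfolding colex_shape_def using X vX N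
      by (intro exI[of _ X] exI[of _ v] exI[of _ N]) simp
    then show ?thesis unfolding extremal_remainder_def
      using N by (intro disjI1 exI[of _ c] exI[of _ j]) simp
  next
    case False
    then have "\<not> 2 \<le> card N" using complete_on_subset_Union[OF N(1)] UX by blast
    then have j: "j = 1" using N by simp
    then obtain u where u: "N = {u}" using N card_1_singletonE by metis
    then have "clique_plus_edge c (H \<union> star v N)"
      unfolding clique_plus_edge_def star_def using X v vX u False
      by (intro exI[of _ X] exI[of _ v] exI[of _ u]) auto
    then show ?thesis unfolding extremal_remainder_def
      using N j by (intro disjI2 exI[of _ c]) simp
  qed
qed

text \<open>If \<open>N\<close> is the main clique of \<open>H\<close>, it simply grows by
  \<open>v\<close>. Another complete set of size \<open>k\<close> exists only if the last row has
  length \<open>k - 1\<close> or if \<open>H\<close> consists of two disjoint edges, and then the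
  parts of \<open>H\<close> exchange roles.\<close>

lemma extremal_remainder_extend_clique:
  assumes H: "extremal_remainder ((k choose 2) + j) H" and v: "v \<notin> \<Union>H" "v \<notin> N"
    and N: "complete_on H N" "card N = k" "j < k"
  shows "extremal_remainder ((Suc k choose 2) + j) (H \<union> star v N)"
\<comment> \<open>With \<open>k = 1\<close> the set \<open>N\<close> is a single vertex, which need
  not lie in \<open>\<Union>H\<close>; the result is one edge.\<close>
proof (cases "k = 1")
  case True
  then have "j = 0" using N by simp
  then have "colex_shape 1 0 H" using extremal_remainder_cases[of k j H] H N True by simp
  then obtain X where X: "finite X" "card X = 1" "H = pairs X"
    unfolding colex_shape_def
    by (metis card_eq_0_iff finite_subset star_empty sup_bot_right)
  then have "H = {}" by (auto simp: card_1_singleton_iff pairs_def card_2_iff)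
  obtain u where u: "N = {u}" using True N card_1_singletonE by metis
  have "pairs {v, u} = star v N" using pairs_insert[of v "{u}"] v u
    by (auto simp: pairs_def card_2_iff)
  then have "colex_shape (Suc k) j (H \<union> star v N)"
    unfolding colex_shape_def using \<open>H = {}\<close> v u True \<open>j = 0\<close>
    by (intro exI[of _ "{v, u}"] exI[of _ v] exI[of _ "{}"]) auto
  then show ?thesis using N unfolding extremal_remainder_def by (metis less_Suc_eq)
next
  case False
  then have k: "2 \<le> k" using N by simp
  have finN: "finite N" using N k by (intro card_ge_0_finite) simp
  have NU: "N \<subseteq> \<Union>H" using complete_on_subset_Union N k by blast
  from extremal_remainder_cases[OF H N(3)] show ?thesis
  proof
    assume "colex_shape k j H"
    then obtain X w D where X: "finite X" "card X = k" "D \<subseteq> X" "card D = j" "D \<noteq> {} \<longrightarrow> w \<notin> X"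
      "H = pairs X \<union> star w D" unfolding colex_shape_def by blast
    have UX: "\<Union>(pairs X) = X" using X k by (simp add: Union_pairs)
    then have vX: "v \<notin> X" using v X by auto
    have "colex_shape (Suc k) j (H \<union> star v N)"
    proof (cases "N \<subseteq> X")
      case True
      then have "N = X" using card_subset_eq X N by metis
      then have "H \<union> star v N = pairs (insert v X) \<union> star w D"
        using X vX by (auto simp: pairs_insert)
      moreover have "w \<notin> insert v X" if "D \<noteq> {}"
        using X that v Union_star[of D w] by auto
      moreover have "finite (insert v X)" "card (insert v X) = Suc k" using X vX by auto
      ultimately show ?thesis unfolding colex_shape_def using X
        by (intro exI[of _ "insert v X"] exI[of _ w] exI[of _ D]) auto
    next
      case False
      have D: "D \<noteq> {}" using False NU X UX by auto
      then have wN: "w \<in> N" using False NU X UX Union_star[of D w] by auto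
      \<comment> \<open>As \<open>w \<in> N\<close>, the other \<open>k - 1\<close> vertices of
        \<open>N\<close> make up all of \<open>D\<close>. So \<open>H\<close> is
        \<open>K_{k+1}\<close> without one edge \<open>{w, x}\<close>, and \<open>x\<close> can take
        over the role of \<open>w\<close>.\<close>
      have "N - {w} \<subseteq> D"
      proof
        fix x assume x: "x \<in> N - {w}"
        then have "{w, x} \<in> H" using N wN by (auto simp: complete_on_def)
        then show "x \<in> D" using X D x by (auto simp: star_def doubleton_eq_iff)
      qed
      moreover have "finite D" using X finite_subset by blast
      moreover have "card D \<le> card (N - {w})" using N X wN finN by simp
      ultimately have ND: "N - {w} = D" using card_seteq by metis
      then have N_eq: "N = insert w D" using wN by auto
      have "card D = k - 1" using ND N wN finN by (metis card_Diff_singleton)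
      then have "card (X - D) = 1" using X k by (simp add: card_Diff_subset finite_subset)
      then obtain x where x: "X - D = {x}" using card_1_singletonE by metis
      then have X_eq: "X = insert x D" "x \<notin> D" using X by auto
      have "H \<union> star v N = pairs (insert v (insert w D)) \<union> star x D"
        using X D vX v N_eq X_eq by (auto simp: pairs_insert)
      moreover have "x \<notin> insert v (insert w D)" using X_eq vX X D by auto
      moreover have "finite N" "card (insert v N) = Suc k" using N v finN by auto
      ultimately show ?thesis
        unfolding colex_shape_def using X N_eq
        by (intro exI[of _ "insert v N"] exI[of _ x] exI[of _ D]) auto
    qed
    then show ?thesis using N unfolding extremal_remainder_def by (metis less_Suc_eq)
  next
    assume "j = 1 \<and> 2 \<le> k \<and> clique_plus_edge k H"
    then obtain X x y where X: "j = 1" "finite X" "card X = k" "x \<notin> X" "y \<notin> X" "x \<noteq> y"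
      "H = pairs X \<union> {{x, y}}" unfolding clique_plus_edge_def by blast
    have UX: "\<Union>(pairs X) = X" using X k by (simp add: Union_pairs)
    then have vX: "v \<notin> X" "v \<noteq> x" "v \<noteq> y" using v X by auto
    have "clique_plus_edge (Suc k) (H \<union> star v N)"
    proof (cases "N \<subseteq> X")
      case True
      then have "N = X" using card_subset_eq X N by metis
      then have "H \<union> star v N = pairs (insert v X) \<union> {{x, y}}"
        using X vX by (auto simp: pairs_insert)
      moreover have "finite (insert v X)" "card (insert v X) = Suc k" using X vX by auto
      ultimately show ?thesis unfolding clique_plus_edge_def using X vX
        by (intro exI[of _ "insert v X"] exI[of _ x] exI[of _ y]) simp
    next
      case False
      then obtain z where z: "z \<in> N" "z \<in> {x, y}" using NU X UX by auto
      \<comment> \<open>A complete set leaving \<open>X\<close> is confined to the separate edge.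
        Hence \<open>k = 2\<close>, and the two disjoint edges of \<open>H\<close> swap
        roles.\<close>
      have "N \<subseteq> {x, y}"
      proof
        fix u assume u: "u \<in> N"
        then have "u = z \<or> {z, u} \<in> H" using N z by (auto simp: complete_on_def)
        then show "u \<in> {x, y}" using X z by (auto simp: doubleton_eq_iff)
      qed
      moreover have "card {x, y} = 2" using X by simp
      ultimately have "N = {x, y}" "k = 2"
        using k N card_mono[of "{x, y}" N] card_subset_eq[of "{x, y}" N] by auto
      obtain p q where pq: "X = {p, q}" "p \<noteq> q" using X \<open>k = 2\<close> by (auto simp: card_2_iff)
      have "H \<union> star v N = pairs (insert v {x, y}) \<union> {{p, q}}"
        using X vX pq pairs_doubleton[of x y] pairs_doubleton[of p q] \<open>N = {x, y}\<close>
        by (auto simp: pairs_insert)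
      moreover have "p \<notin> insert v {x, y}" "q \<notin> insert v {x, y}" using X vX pq by auto
      moreover have "card (insert v {x, y}) = Suc k" using X vX \<open>k = 2\<close> by simp
      ultimately show ?thesis
        unfolding clique_plus_edge_def using pq
        by (intro exI[of _ "insert v {x, y}"] exI[of _ p] exI[of _ q]) simp
    qed
    then show ?thesis unfolding extremal_remainder_def
      using X k by (intro disjI2 exI[of _ "Suc k"]) simp
  qed
qed

text \<open>A vertex of a component \<open>K\<^bsub>r+1\<^esub>\<close> already has degree \<open>r\<close>, so a new vertex can only be joined
  to the remainder.\<close>

lemma with_cliques_attach:
  assumes "with_cliques (Suc r) P a E" "simple_edges E" "1 \<le> r" "v \<notin> \<Union>E" "v \<notin> N" "finite N"
    and "complete_on E N" "\<And>u. card (nbrs (E \<union> star v N) u) \<le> r"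
    and base: "\<And>H. P H \<Longrightarrow> v \<notin> \<Union>H \<Longrightarrow> complete_on H N \<Longrightarrow> Q (H \<union> star v N)"
  shows "with_cliques (Suc r) Q a (E \<union> star v N)"
  using assms(1,2,4,7,8)
proof (induction a arbitrary: E)
  case 0
  then show ?case using base by simp
next
  case (Suc a)
  from Suc.prems(1) obtain Y F where Y: "finite Y" "card Y = Suc r" "Y \<inter> \<Union>F = {}" "E = F \<union> pairs Y"
    "with_cliques (Suc r) P a F" by auto
  have UY: "\<Union>(pairs Y) = Y" using Y assms(3) by (intro Union_pairs) simp
  have vY: "v \<notin> Y" using Suc.prems Y UY by auto
  have simple: "simple_edges (E \<union> star v N)"
    using Suc.prems(2) assms(5,6) by (intro simple_edges_Un simple_edges_star)
  have NY: "y \<notin> N" if y: "y \<in> Y" for y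
  proof
    assume yN: "y \<in> N"
    have "insert v (Y - {y}) \<subseteq> nbrs (E \<union> star v N) y"
      using y yN Y by (auto simp: nbrs_def star_def insert_commute)
    then have "card (insert v (Y - {y})) \<le> card (nbrs (E \<union> star v N) y)"
      using finite_nbrs[OF simple] card_mono by blast
    moreover have "card (insert v (Y - {y})) = Suc r" using Y y vY by simp
    ultimately show False using Suc.prems(5)[of y] by simp
  qed
  have "card (nbrs (F \<union> star v N) u) \<le> r" for u
  proof -
    have "card (nbrs (F \<union> star v N) u) \<le> card (nbrs (E \<union> star v N) u)"
      using Y by (intro card_mono finite_nbrs[OF simple]) (auto simp: nbrs_def)
    with Suc.prems(5)[of u] show ?thesis by simp
  qed
  moreover have "complete_on F N"
    unfolding complete_on_def
  proof (intro ballI impI)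
    fix x y assume xy: "x \<in> N" "y \<in> N" "x \<noteq> y"
    then have "{x, y} \<in> F \<union> pairs Y" using Suc.prems(4) Y(4) by (auto simp: complete_on_def)
    then show "{x, y} \<in> F" using NY xy by auto
  qed
  moreover have "simple_edges F" "v \<notin> \<Union>F"
    using Suc.prems Y by (auto intro: simple_edges_subset)
  ultimately have "with_cliques (Suc r) Q a (F \<union> star v N)" using Suc.IH Y by blast
  moreover have "Y \<inter> \<Union>(F \<union> star v N) = {}" using Y vY NY by (auto simp: star_def)
  moreover have "E \<union> star v N = (F \<union> star v N) \<union> pairs Y" using Y by blast
  ultimately show ?case using Y by auto
qed

section \<open>The induction on the number of edges\<close>

lemma avoiding_Un_star:
  assumes "simple_edges E"
  shows "E = avoiding E {v} \<union> star v (nbrs E v)"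
  using edges_at_eq_star[OF assms, of v] by (auto simp: avoiding_def)

text \<open>Only the direction from equality to structure is carried through the induction, since it
  rebuilds \<open>E\<close> from the smaller edge set. The converse is the direct count in
  \<open>clique_count_with_cliques\<close>.\<close>

theorem clique_count_bound:
  assumes "simple_edges E" "1 \<le> r" "\<And>v. card (nbrs E v) \<le> r"
    and "card E = a * (Suc r choose 2) + b" "b < Suc r choose 2"
  shows "int (clique_count E) \<le> int a * colex_kappa (Suc r choose 2) + colex_kappa b \<and>
    (int (clique_count E) = int a * colex_kappa (Suc r choose 2) + colex_kappa b \<longrightarrow>
     with_cliques (Suc r) (extremal_remainder b) a E)"
  using assms(1,3-5)
proof (induction "card E" arbitrary: E a b rule: less_induct)
  case less
  let ?N = "Suc r choose 2"
  note simple = less.prems(1) and deg = less.prems(2) and m = less.prems(3) and b = less.prems(4)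
  have finE: "finite E" using simple by (simp add: simple_edges_def)
  have Npos: "0 < ?N" using b by linarith
  have IH_bound: "int (clique_count F) \<le> clique_bound ?N (card F)"
    if "F \<subseteq> E" "card F < card E" for F
  proof -
    have F: "simple_edges F" using simple that simple_edges_subset by blast
    have "card (nbrs F v) \<le> r" for v
    proof -
      have "card (nbrs F v) \<le> card (nbrs E v)"
        using that by (intro card_mono finite_nbrs[OF simple]) (auto simp: nbrs_def)
      with deg[of v] show ?thesis by simp
    qed
    then show ?thesis
      using less.hyps[OF that(2) F _ div_mult_mod_eq[symmetric] mod_less_divisor[OF Npos]]
      unfolding clique_bound_def by blast
  qed
  have IH_extremal: "with_cliques (Suc r) (extremal_remainder b') a' F"
    if "F \<subseteq> E" "card F < card E" "card F = a' * ?N + b'" "b' < ?N"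
      "int (clique_count F) = int a' * colex_kappa ?N + colex_kappa b'" for F a' b'
  proof -
    have F: "simple_edges F" using simple that simple_edges_subset by blast
    have "card (nbrs F v) \<le> r" for v
    proof -
      have "card (nbrs F v) \<le> card (nbrs E v)"
        using that by (intro card_mono finite_nbrs[OF simple]) (auto simp: nbrs_def)
      with deg[of v] show ?thesis by simp
    qed
    then show ?thesis using less.hyps[OF that(2) F _ that(3,4)] that(5) by blast
  qed
  show ?case
  proof (cases "E = {}")
    case True
    then have "a = 0" "b = 0" using m Npos by auto
    moreover have "pairs {} = E" using True by (auto simp: pairs_def)
    then have "clique_count E = 0"
      using clique_count_pairs[of "{} :: 'a set"] by (simp add: binomial_eq_0)
    \<comment> \<open>The representation of 0 with \<open>j < c\<close> is \<open>c = 1\<close>,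
      \<open>j = 0\<close>, so the clique has one vertex, which may be any element of the
      type.\<close>
    moreover have "colex_shape 1 0 E"
      unfolding colex_shape_def using True
      by (intro exI[of _ "{undefined}"] exI[of _ undefined] exI[of _ "{}"])
        (auto simp: pairs_def card_2_iff)
    then have "extremal_remainder 0 E"
      unfolding extremal_remainder_def by (intro disjI1 exI[of _ 1] exI[of _ 0]) simp
    ultimately show ?thesis by simp
  next
    case False
    obtain c j where c: "b = (c choose 2) + j" "j < c" using colex_representation by blast
    show ?thesis
    proof (cases "\<exists>v\<in>\<Union>E. card (nbrs E v) < c")
      case True
      then obtain v where v: "v \<in> \<Union>E" "card (nbrs E v) < c" by blast
      define d where "d = card (nbrs E v)"
      define F where "F = avoiding E {v}"
      have FE: "F \<subseteq> E" by (auto simp: F_def avoiding_def)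
      have simpleF: "simple_edges F" unfolding F_def by (rule simple_edges_avoiding[OF simple])
      have vF: "v \<notin> \<Union>F" by (auto simp: F_def avoiding_def)
      have E: "E = F \<union> star v (nbrs E v)" unfolding F_def by (rule avoiding_Un_star[OF simple])
      have vN: "v \<notin> nbrs E v" using simple by (rule not_mem_nbrs)
      have "nbrs E v \<noteq> {}"
      proof
        assume "nbrs E v = {}"
        then have "E = F" using E by simp
        then show False using v vF by blast
      qed
      then have dpos: "0 < d" using finite_nbrs[OF simple] by (simp add: d_def card_gt_0_iff)
      have "{e \<in> E. e \<inter> {v} \<noteq> {}} = {e \<in> E. v \<in> e}" by auto
      then have cardF: "card E = card F + d"
        using card_avoiding[OF simple, of "{v}"] card_edges_at[OF simple, of v] by (simp add: F_def d_def)
      obtain k where k: "c = Suc k" using c by (cases c) auto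
      have "d \<le> k" using v k by (simp add: d_def)
      \<comment> \<open>By \<open>d \<le> c - 1 \<le> c choose 2 \<le> b\<close> the remainder alone
        pays for the deletion, and \<open>a\<close> is unchanged.\<close>
      then have db: "d \<le> b" using c k by (simp add: choose_two_Suc)
      then have cardF': "card F = a * ?N + (b - d)" "b - d < ?N" using cardF m b by auto
      have countE: "int (clique_count E) =
        int (clique_count F) + int (card {S \<in> cliques E. S \<inter> {v} \<noteq> {}})"
        using clique_count_avoiding[OF simple, of "{v}"] unfolding F_def by (simp only: of_nat_add)
      have at: "int (card {S \<in> cliques E. S \<inter> {v} \<noteq> {}}) \<le> 2 ^ d - 1"
        using of_nat_mono[OF card_cliques_at(1)[OF simple, of v], where 'a = int]
        by (simp add: d_def)
      have boundF: "int (clique_count F) \<le> int a * colex_kappa ?N + colex_kappa (b - d)"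
        using IH_bound[OF FE] cardF dpos clique_bound_eq[OF cardF'(2), of a] cardF'(1) by simp
      have step: "colex_kappa (b - d) + 2 ^ d - 1 \<le> colex_kappa b"
        using colex_kappa_remove_vertex(1)[of d c j] v c by (simp add: d_def)
      have bound: "int (clique_count E) \<le> int a * colex_kappa ?N + colex_kappa b"
        using countE at boundF step by linarith
      moreover have "with_cliques (Suc r) (extremal_remainder b) a E"
        if eq: "int (clique_count E) = int a * colex_kappa ?N + colex_kappa b"
      proof -
        \<comment> \<open>Equality in the sum of the estimates forces equality in each of
          them.\<close>
        have eqs: "int (clique_count F) = int a * colex_kappa ?N + colex_kappa (b - d)"
          "int (card {S \<in> cliques E. S \<inter> {v} \<noteq> {}}) = 2 ^ d - 1"
          "colex_kappa (b - d) + 2 ^ d - 1 = colex_kappa b"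
          using countE at boundF step eq by linarith+
        have wF: "with_cliques (Suc r) (extremal_remainder (b - d)) a F"
          using IH_extremal[OF FE _ cardF' eqs(1)] cardF dpos by simp
        have "int (card {S \<in> cliques E. S \<inter> {v} \<noteq> {}}) = int (2 ^ card (nbrs E v) - 1)"
          using eqs(2) by (simp add: d_def)
        then have "complete_on E (nbrs E v)"
          using card_cliques_at(2)[OF simple, of v] of_nat_eq_iff by blast
        then have complF: "complete_on F (nbrs E v)"
          using vN by (auto simp: complete_on_def F_def avoiding_def)
        \<comment> \<open>The case \<open>d = 0\<close> is excluded because \<open>v\<close> lies on
          an edge. Of the other two, \<open>d = j\<close> restores the last row and
          \<open>d = k\<close> enlarges the clique.\<close>
        have dj: "d = j \<or> d = k \<and> j < d"
          using colex_kappa_remove_vertex(2)[of d c j] eqs(3) c v dpos k by (auto simp: d_def)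
        have base: "extremal_remainder b (H \<union> star v (nbrs E v))"
          if "extremal_remainder (b - d) H" "v \<notin> \<Union>H" "complete_on H (nbrs E v)" for H
          using dj
        proof
          assume "d = j"
          then show ?thesis
            using extremal_remainder_attach_to_clique[of c H v "nbrs E v" j] that vN c dpos
            by (simp add: d_def)
        next
          assume *: "d = k \<and> j < d"
          then have "b - d = (k choose 2) + j" using c k by (simp add: choose_two_Suc)
          then show ?thesis
            using extremal_remainder_extend_clique[of k j H v "nbrs E v"] that vN c k *
            by (simp add: d_def)
        qed
        have "with_cliques (Suc r) (extremal_remainder b) a (F \<union> star v (nbrs E v))"
          using deg E base
          by (intro with_cliques_attach[OF wF simpleF assms(2) vF vN finite_nbrs[OF simple] complF]) auto
        then show ?thesis using E by simp
      qed
      ultimately show ?thesis by blast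
    next
      case high: False
      obtain v where v: "v \<in> \<Union>E"
        "card (touching_cliques E v) \<le> card {T. T \<subseteq> nbrs E v \<and> 3 \<le> card T}"
        using exists_few_touching_cliques[OF simple False] by blast
      define d where "d = card (nbrs E v)"
      define A where "A = insert v (nbrs E v)"
      define s where "s = card {e \<in> E. e \<inter> A \<noteq> {}}"
      define s' where "s' = min s (Suc d choose 2)"
      define I where "I = induced E (nbrs E v)"
      define i where "i = card I"
      define F where "F = avoiding E A"
      have finN: "finite (nbrs E v)" and vN: "v \<notin> nbrs E v"
        by (fact finite_nbrs[OF simple] not_mem_nbrs[OF simple])+
      have cd: "c \<le> d" "d \<le> r" using high v deg by (auto simp: d_def not_less)
      have c1: "1 \<le> c" using c by simp
      have bc: "b < Suc c choose 2" "c choose 2 \<le> b" using c by (auto simp: choose_two_Suc)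
      have IB: "I \<subseteq> pairs (nbrs E v)" using simple by (auto simp: I_def induced_def pairs_def simple_edges_def)
      have finB: "finite (pairs (nbrs E v))" using simple_edges_pairs[OF finN] by (simp add: simple_edges_def)
      have ib: "i \<le> d choose 2"
        using card_mono[OF finB IB] finN by (simp add: i_def d_def card_pairs)
      have s1: "d + i \<le> s"
        using degree_plus_card_induced_le[OF simple, of v] by (simp add: d_def i_def I_def s_def A_def)
      \<comment> \<open>The centre contributes \<open>d\<close> to the degree sum over
        \<open>A\<close>, and each of its \<open>d\<close> neighbours at least
        \<open>c\<close>.\<close>
      have "d * (c + 1) = d + (\<Sum>u\<in>nbrs E v. c)" by (simp add: d_def)
      also have "\<dots> \<le> d + (\<Sum>u\<in>nbrs E v. card (nbrs E u))"
        using high nbrs_subset_Union[of E v] by (intro add_left_mono sum_mono) (auto simp: not_less)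
      also have "\<dots> = (\<Sum>u\<in>A. card (nbrs E u))" using finN vN by (simp add: A_def d_def)
      also have "\<dots> \<le> 2 * s" unfolding s_def using simple finN by (intro sum_degrees_le) (simp_all add: A_def)
      finally have s2: "d * (c + 1) \<le> 2 * s" .
      note num = colex_kappa_remove_neighbourhood[OF bc c1 cd ib s1 s2 s'_def]
      have cardF: "card E = card F + s" unfolding F_def s_def by (rule card_avoiding[OF simple])
      have s': "s' \<le> s" "b < s'" using num(1) by (auto simp: s'_def)
      have FE: "F \<subseteq> E" by (auto simp: F_def avoiding_def)
      have IE: "I \<subseteq> E" by (auto simp: I_def induced_def)
      have dpos: "0 < d" using c1 cd by simp
      have Icard: "card I < card E" using s1 dpos cardF by (simp add: i_def)
      have "d choose 2 < ?N"
      proof -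
        have "Suc d choose 2 \<le> ?N" using cd by (intro choose_two_mono) simp
        then show ?thesis using dpos by (simp add: choose_two_Suc)
      qed
      then have iN: "i < ?N" using ib by simp
      have countI: "int (clique_count I) \<le> colex_kappa i"
        using IH_bound[OF IE Icard] iN by (simp add: clique_bound_def i_def)
      have s'N: "s' \<le> ?N"
      proof -
        have "Suc d choose 2 \<le> ?N" using cd by (intro choose_two_mono) simp
        then show ?thesis by (simp add: s'_def)
      qed
      have "a \<noteq> 0"
      proof
        assume "a = 0"
        then have "card E = b" using m by simp
        then show False using cardF s' by simp
      qed
      then obtain a' where a': "a = Suc a'" using not0_implies_Suc by blast
      \<comment> \<open>The cap on \<open>s'\<close> ensures that just one full block is broken up.
        The \<open>s - s'\<close> excess edges are returned to the edge count of \<open>F\<close>,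
        where the bound grows by at least one for each.\<close>
      have Fs: "card F + (s - s') = a' * ?N + (?N + b - s')" "?N + b - s' < ?N"
        using cardF m a' s' s'N by (auto simp: algebra_simps)
      have "int (clique_count F) + int (s - s') \<le> clique_bound ?N (card F + (s - s'))"
        using IH_bound[OF FE] cardF s' clique_bound_add[OF Npos, of "card F" "s - s'"] by simp
      then have countF: "int (clique_count F) + int s - int s' \<le>
        int a' * colex_kappa ?N + colex_kappa (?N + b - s')"
        using clique_bound_eq[OF Fs(2), of a'] Fs(1) s' by simp
      have touch: "int (card (touching_cliques E v)) \<le> colex_kappa (d choose 2) - int (d choose 2)"
        using v(2) card_subsets_ge_3[OF finN] by (simp add: d_def)
      have countE: "int (clique_count E) =
        int (clique_count F) + int s + int (clique_count I) + int (card (touching_cliques E v))"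
        using clique_count_avoiding[OF simple, of A] card_cliques_meeting_neighbourhood[OF simple, of v]
        by (simp add: F_def A_def s_def I_def)
      have aN: "int a * colex_kappa ?N = int a' * colex_kappa ?N + colex_kappa ?N"
        using a' by (simp add: algebra_simps)
      have bound: "int (clique_count E) \<le> int a * colex_kappa ?N + colex_kappa b"
        using countE countF touch countI num(2) aN by linarith
      moreover have "with_cliques (Suc r) (extremal_remainder b) a E"
        if eq: "int (clique_count E) = int a * colex_kappa ?N + colex_kappa b"
      proof -
        \<comment> \<open>The numerical estimate must be tight, so the centre has degree
          \<open>r\<close> and its neighbours are pairwise adjacent.\<close>
        have dr: "d = r" "i = d choose 2"
          using num(3) countE countF touch countI num(2) aN eq by linarith+
        have "I = pairs (nbrs E v)"
          using card_subset_eq[OF finB IB] dr finN by (simp add: i_def d_def card_pairs)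
        then have pE: "pairs (nbrs E v) \<subseteq> E" using IE by simp
        have pA: "pairs A \<subseteq> E"
          unfolding A_def pairs_insert[OF vN] using pE by (auto simp: star_def nbrs_def)
        have cardA: "finite A" "card A = Suc r" using finN vN dr by (auto simp: A_def d_def)
        \<comment> \<open>A vertex of \<open>A\<close> already has \<open>r\<close> neighbours
          inside \<open>A\<close>, so the degree bound makes \<open>A\<close> a component.\<close>
        have nbrsA: "nbrs E u = A - {u}" if u: "u \<in> A" for u
        proof -
          have "A - {u} \<subseteq> nbrs E u"
          proof
            fix x assume "x \<in> A - {u}"
            then have "{u, x} \<in> pairs A" using u by auto
            then show "x \<in> nbrs E u" using pA by (auto simp: nbrs_def)
          qed
          moreover have "card (nbrs E u) \<le> card (A - {u})" using deg[of u] cardA u by simp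
          ultimately show ?thesis using card_seteq finite_nbrs[OF simple] by metis
        qed
        have E: "E = F \<union> pairs A"
        proof
          show "E \<subseteq> F \<union> pairs A"
          proof
            fix e assume e: "e \<in> E"
            show "e \<in> F \<union> pairs A"
            proof (cases "e \<inter> A = {}")
              case False
              then obtain u where u: "u \<in> e" "u \<in> A" by blast
              then have "e \<in> star u (nbrs E u)" using edges_at_eq_star[OF simple, of u] e by blast
              then obtain x where "e = {u, x}" "x \<in> A - {u}"
                unfolding nbrsA[OF u(2)] star_def by blast
              then have "e \<in> pairs A" using u by auto
              then show ?thesis by blast
            qed (use e in \<open>simp add: F_def avoiding_def\<close>)
          qed
        qed (use FE pA in blast)
        have disj: "A \<inter> \<Union>F = {}" by (auto simp: F_def avoiding_def)
        have "\<Union>F \<inter> \<Union>(pairs A) = {}" using disj Union_pairs_subset[of A] by blast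
        moreover have "simple_edges F" using simple FE simple_edges_subset by blast
        ultimately have "clique_count E = clique_count F + clique_count (pairs A)"
          unfolding E by (intro clique_count_disjoint_Un simple_edges_pairs[OF cardA(1)])
        then have countF': "int (clique_count F) = int a' * colex_kappa ?N + colex_kappa b"
          using clique_count_pairs[OF cardA(1)] eq aN unfolding cardA(2) by linarith
        have "F \<inter> pairs A = {}"
        proof (rule ccontr)
          assume "F \<inter> pairs A \<noteq> {}"
          then obtain e where "e \<in> F" "e \<in> pairs A" by blast
          then have "e \<inter> A = {}" "e \<subseteq> A" "card e = 2" by (auto simp: F_def avoiding_def pairs_def)
          then show False by (metis card.empty inf.orderE zero_neq_numeral)
        qed
        then have "card E = card F + ?N"
          using E cardA finE by (metis card_Un_disjoint card_pairs finite_Un)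
        then have "card F < card E" "card F = a' * ?N + b"
          using Npos m unfolding a' mult_Suc by linarith+
        then have "with_cliques (Suc r) (extremal_remainder b) a' F"
          using IH_extremal[OF FE _ _ b countF'] by blast
        then show ?thesis using cardA disj E a' by auto
      qed
      ultimately show ?thesis by blast
    qed
  qed
qed

section \<open>Isomorphism of extremal graphs\<close>

text \<open>Isomorphism after removal of isolated vertices, without vertex sets to carry along; see
  \<open>iso_upto_isolated_iff_edge_iso\<close>.\<close>

definition edge_iso :: "'a set set \<Rightarrow> 'b set set \<Rightarrow> bool" where
  "edge_iso E F \<longleftrightarrow> (\<exists>f. inj_on f (\<Union>E) \<and> F = (`) f ` E)"

lemma iso_upto_isolated_iff_edge_iso:
  assumes G: "simple_graph G" and H: "simple_graph H"
  shows "iso_upto_isolated G H \<longleftrightarrow> edge_iso (edges G) (edges H)"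
proof -
  have vG: "verts (remove_isolated G) = \<Union>(edges G)" and vH: "verts (remove_isolated H) = \<Union>(edges H)"
    using G H by (auto simp: remove_isolated_def simple_graph_def)
  have eG: "edges (remove_isolated G) = edges G" and eH: "edges (remove_isolated H) = edges H"
    by (auto simp: remove_isolated_def)
  show ?thesis
  proof
    assume "iso_upto_isolated G H"
    then obtain f where f: "bij_betw f (\<Union>(edges G)) (\<Union>(edges H))"
      and ff: "\<And>u v. u \<in> \<Union>(edges G) \<Longrightarrow> v \<in> \<Union>(edges G) \<Longrightarrow> {u, v} \<in> edges G \<longleftrightarrow> {f u, f v} \<in> edges H"
      unfolding iso_upto_isolated_def graph_iso_def vG vH eG eH by blast
    have "edges H = (`) f ` edges G"
    proof (intro equalityI subsetI)
      fix e assume e: "e \<in> edges H"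
      then obtain x y where xy: "e = {x, y}" using H by (auto simp: simple_graph_def card_2_iff)
      then have "x \<in> f ` \<Union>(edges G)" "y \<in> f ` \<Union>(edges G)"
        using e f by (auto simp: bij_betw_def)
      then obtain u v where uv: "u \<in> \<Union>(edges G)" "v \<in> \<Union>(edges G)" "x = f u" "y = f v" by blast
      then have "{u, v} \<in> edges G" using ff e xy by simp
      moreover have "e = f ` {u, v}" using uv xy by simp
      ultimately show "e \<in> (`) f ` edges G" by blast
    next
      fix e assume "e \<in> (`) f ` edges G"
      then obtain e' where e': "e' \<in> edges G" "e = f ` e'" by blast
      then obtain x y where "e' = {x, y}" using G by (auto simp: simple_graph_def card_2_iff)
      then show "e \<in> edges H" using e' ff[of x y] by auto
    qed
    then show "edge_iso (edges G) (edges H)" using f by (auto simp: edge_iso_def bij_betw_def)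
  next
    assume "edge_iso (edges G) (edges H)"
    then obtain f where f: "inj_on f (\<Union>(edges G))" "edges H = (`) f ` edges G"
      by (auto simp: edge_iso_def)
    have "bij_betw f (\<Union>(edges G)) (\<Union>(edges H))" using f by (auto simp: bij_betw_def)
    moreover have "{u, v} \<in> edges G \<longleftrightarrow> {f u, f v} \<in> edges H"
      if uv: "u \<in> \<Union>(edges G)" "v \<in> \<Union>(edges G)" for u v
    proof
      assume "{u, v} \<in> edges G"
      then have "f ` {u, v} \<in> edges H" unfolding f(2) by (rule imageI)
      then show "{f u, f v} \<in> edges H" by simp
    next
      assume "{f u, f v} \<in> edges H"
      then obtain e where e: "e \<in> edges G" "f ` {u, v} = f ` e" unfolding f(2) by auto
      then have "{u, v} = e" using inj_on_image_eq_iff[OF f(1), of "{u, v}" e] uv by blast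
      with e show "{u, v} \<in> edges G" by simp
    qed
    ultimately show "iso_upto_isolated G H"
      unfolding iso_upto_isolated_def graph_iso_def vG vH eG eH by blast
  qed
qed

lemma clique_count_edge_iso:
  assumes "edge_iso E F"
  shows "clique_count F = clique_count E"
proof -
  obtain f where f: "inj_on f (\<Union>E)" "F = (`) f ` E" using assms by (auto simp: edge_iso_def)
  have inj: "inj_on f S" if "S \<in> cliques E" for S
    using inj_on_subset[OF f(1) clique_subset_Union[OF that]] .
  have "cliques F = (`) f ` cliques E"
  proof (intro equalityI subsetI)
    fix T assume T: "T \<in> cliques F"
    have "T \<subseteq> f ` \<Union>E" using clique_subset_Union[OF T] unfolding f(2) by blast
    then obtain S where S: "S \<subseteq> \<Union>E" "T = f ` S" by (meson subset_imageE)
    have "inj_on f S" using inj_on_subset[OF f(1) S(1)] .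
    then have "finite S" "2 \<le> card S" using T S by (auto simp: cliques_def card_image finite_image_iff)
    moreover have "complete_on E S"
      unfolding complete_on_def
    proof (intro ballI impI)
      fix u v assume uv: "u \<in> S" "v \<in> S" "u \<noteq> v"
      then have "f u \<noteq> f v" using \<open>inj_on f S\<close> by (auto dest: inj_onD)
      then have "{f u, f v} \<in> F" using uv T S by (auto simp: cliques_def complete_on_def)
      then obtain e where e: "e \<in> E" "f ` {u, v} = f ` e" unfolding f(2) by auto
      then have "{u, v} = e" using inj_on_image_eq_iff[OF f(1), of "{u, v}" e] uv S by blast
      with e show "{u, v} \<in> E" by simp
    qed
    ultimately show "T \<in> (`) f ` cliques E" using S by (auto simp: cliques_def)
  next
    fix T assume "T \<in> (`) f ` cliques E"
    then obtain S where S: "S \<in> cliques E" "T = f ` S" by blast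
    have "{f u, f v} \<in> F" if "u \<in> S" "v \<in> S" "f u \<noteq> f v" for u v
    proof -
      have "{u, v} \<in> E" using S that by (auto simp: cliques_def complete_on_def)
      then have "f ` {u, v} \<in> F" unfolding f(2) by (rule imageI)
      then show ?thesis by simp
    qed
    then show "T \<in> cliques F"
      using S inj[OF S(1)] by (auto simp: cliques_def complete_on_def card_image)
  qed
  moreover have "inj_on ((`) f) (cliques E)"
  proof (rule inj_onI)
    fix S T assume "S \<in> cliques E" "T \<in> cliques E" "f ` S = f ` T"
    then show "S = T"
      using inj_on_image_eq_iff[OF f(1) clique_subset_Union clique_subset_Union] by simp
  qed
  ultimately show ?thesis by (simp add: clique_count_def card_image)
qed

lemma image_pairs:
  assumes "inj_on f X"
  shows "(`) f ` pairs X = pairs (f ` X)"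
proof (intro equalityI subsetI)
  fix e assume "e \<in> (`) f ` pairs X"
  then obtain e' where "e' \<subseteq> X" "card e' = 2" "e = f ` e'" by (auto simp: pairs_def)
  then show "e \<in> pairs (f ` X)"
    using card_image[OF inj_on_subset[OF assms]] by (auto simp: pairs_def)
next
  fix e assume e: "e \<in> pairs (f ` X)"
  then obtain e' where e': "e' \<subseteq> X" "e = f ` e'" by (auto simp: pairs_def subset_image_iff)
  then have "card e' = 2" using e card_image[OF inj_on_subset[OF assms]] by (auto simp: pairs_def)
  then show "e \<in> (`) f ` pairs X" using e' by (auto simp: pairs_def)
qed

lemma image_star: "(`) f ` star w D = star (f w) (f ` D)"
  by (auto simp: star_def image_image)

lemma edge_iso_pairs:
  assumes "finite X" "finite Y" "card X = card Y"
  shows "edge_iso (pairs X) (pairs Y)"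
proof -
  obtain f where f: "bij_betw f X Y" using finite_same_card_bij assms by blast
  then have "inj_on f (\<Union>(pairs X))" using inj_on_subset Union_pairs_subset by (metis bij_betw_def)
  moreover have "pairs Y = (`) f ` pairs X" using f by (simp add: image_pairs bij_betw_def)
  ultimately show ?thesis by (auto simp: edge_iso_def)
qed

lemma edge_iso_disjoint_Un:
  assumes "edge_iso E E'" "edge_iso F F'" "\<Union>E \<inter> \<Union>F = {}" "\<Union>E' \<inter> \<Union>F' = {}"
  shows "edge_iso (E \<union> F) (E' \<union> F')"
proof -
  obtain f g where f: "inj_on f (\<Union>E)" "E' = (`) f ` E" and g: "inj_on g (\<Union>F)" "F' = (`) g ` F"
    using assms(1,2) by (auto simp: edge_iso_def)
  define h where "h x = (if x \<in> \<Union>E then f x else g x)" for x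
  have hf: "h x = f x" if "x \<in> \<Union>E" for x using that by (simp add: h_def)
  have hg: "h x = g x" if "x \<in> \<Union>F" for x
  proof -
    have "x \<notin> \<Union>E" using that assms(3) by blast
    then show ?thesis unfolding h_def by (rule if_not_P)
  qed
  have hE: "h ` e = f ` e" if "e \<in> E" for e using that hf by (intro image_cong) auto
  have hF: "h ` e = g ` e" if "e \<in> F" for e using that hg by (intro image_cong) auto
  have "(`) h ` E = (`) f ` E" "(`) h ` F = (`) g ` F" using hE hF by (auto intro!: image_cong)
  then have "E' \<union> F' = (`) h ` (E \<union> F)" using f g by (simp add: image_Un)
  moreover have "inj_on h (\<Union>E \<union> \<Union>F)"
  proof -
    have "inj_on h (\<Union>E)" using f(1) hf inj_on_cong by metis
    moreover have "inj_on h (\<Union>F)" using g(1) hg inj_on_cong by metis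
    moreover have "h ` \<Union>E = \<Union>E'" "h ` \<Union>F = \<Union>F'"
      using f(2) g(2) hE hF by (simp_all add: image_Union)
    ultimately show ?thesis using assms(4) by (auto simp: inj_on_Un)
  qed
  ultimately show ?thesis unfolding edge_iso_def by auto
qed

text \<open>Matching the split-off cliques one by one reduces the isomorphism to the remainders,
  where the shape determines the edge set.\<close>

lemma edge_iso_with_cliques:
  assumes "with_cliques n P a E" "with_cliques n Q a F"
    and "\<And>H K. P H \<Longrightarrow> Q K \<Longrightarrow> edge_iso H K"
  shows "edge_iso E F"
  using assms(1,2)
proof (induction a arbitrary: E F)
  case 0
  then show ?case using assms(3) by simp
next
  case (Suc a)
  obtain Y E0 where E: "finite Y" "card Y = n" "Y \<inter> \<Union>E0 = {}" "E = E0 \<union> pairs Y" "with_cliques n P a E0"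
    using Suc.prems(1) by auto
  obtain Z F0 where F: "finite Z" "card Z = n" "Z \<inter> \<Union>F0 = {}" "F = F0 \<union> pairs Z" "with_cliques n Q a F0"
    using Suc.prems(2) by auto
  have "\<Union>E0 \<inter> \<Union>(pairs Y) = {}" "\<Union>F0 \<inter> \<Union>(pairs Z) = {}"
    using E(3) F(3) Union_pairs_subset[of Y] Union_pairs_subset[of Z] by fast+
  then show ?case using edge_iso_disjoint_Un[OF Suc.IH[OF E(5) F(5)] edge_iso_pairs[of Y Z]] E F by simp
qed

lemma edge_iso_colex_shape:
  assumes "colex_shape c j E" "colex_shape c j F"
  shows "edge_iso E F"
proof -
  obtain X w D where E: "finite X" "card X = c" "D \<subseteq> X" "card D = j" "D \<noteq> {} \<longrightarrow> w \<notin> X"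
    "E = pairs X \<union> star w D" using assms(1) unfolding colex_shape_def by blast
  obtain Y z B where F: "finite Y" "card Y = c" "B \<subseteq> Y" "card B = j" "B \<noteq> {} \<longrightarrow> z \<notin> Y"
    "F = pairs Y \<union> star z B" using assms(2) unfolding colex_shape_def by blast
  have finD: "finite D" "finite B" using finite_subset[OF E(3,1)] finite_subset[OF F(3,1)] .
  obtain f where f: "bij_betw f D B" using finite_same_card_bij[OF finD] E(4) F(4) by auto
  have "card (X - D) = card (Y - B)" using E F finD by (simp add: card_Diff_subset)
  then obtain g where g: "bij_betw g (X - D) (Y - B)"
    using finite_same_card_bij[of "X - D" "Y - B"] E(1) F(1) by auto
  \<comment> \<open>The last branch serves \<open>w\<close>, which lies outside \<open>X\<close>
    whenever \<open>D\<close> is nonempty.\<close>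
  define h where "h x = (if x \<in> D then f x else if x \<in> X then g x else z)" for x
  have hD: "bij_betw h D B" using f by (rule bij_betw_cong[THEN iffD1, rotated]) (simp add: h_def)
  have hXD: "bij_betw h (X - D) (Y - B)"
    using g by (rule bij_betw_cong[THEN iffD1, rotated]) (simp add: h_def)
  have "bij_betw h (D \<union> (X - D)) (B \<union> (Y - B))"
    using hD hXD by (rule bij_betw_combine) blast
  moreover have "D \<union> (X - D) = X" "B \<union> (Y - B) = Y" using E F by auto
  ultimately have hX: "bij_betw h X Y" by simp
  have pairs: "(`) h ` pairs X = pairs Y" using hX by (simp add: image_pairs bij_betw_def)
  show ?thesis
  proof (cases "D = {}")
    case True
    then have "B = {}" using E F finD by auto
    then show ?thesis using True E F edge_iso_pairs[of X Y] by simp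
  next
    case False
    then have BY: "B \<noteq> {}" using E F finD by auto
    have w: "w \<notin> X" "z \<notin> Y" using E F False BY by auto
    then have hw: "h w = z" using E by (auto simp: h_def)
    have "(`) h ` star w D = star z B" using hD hw by (simp add: image_star bij_betw_def)
    then have "F = (`) h ` E" using E F pairs by (simp add: image_Un)
    moreover have "inj_on h (insert w X)" using hX w hw by (auto simp: bij_betw_def)
    moreover have "\<Union>E \<subseteq> insert w X" using E Union_pairs_subset[of X] by (auto simp: star_def)
    ultimately show ?thesis unfolding edge_iso_def using inj_on_subset[of h "insert w X" "\<Union>E"] by blast
  qed
qed

lemma edge_iso_clique_plus_edge:
  assumes "clique_plus_edge c E" "clique_plus_edge c F"
  shows "edge_iso E F"
proof -
  obtain X x y where E: "finite X" "card X = c" "x \<notin> X" "y \<notin> X" "x \<noteq> y" "E = pairs X \<union> {{x, y}}"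
    using assms(1) unfolding clique_plus_edge_def by blast
  obtain Y u v where F: "finite Y" "card Y = c" "u \<notin> Y" "v \<notin> Y" "u \<noteq> v" "F = pairs Y \<union> {{u, v}}"
    using assms(2) unfolding clique_plus_edge_def by blast
  have 1: "edge_iso (pairs X) (pairs Y)" using E F edge_iso_pairs by metis
  have 2: "edge_iso {{x, y}} {{u, v}}"
    using edge_iso_pairs[of "{x, y}" "{u, v}"] E F by (simp add: pairs_doubleton)
  show ?thesis
    unfolding E(6) F(6) using E F Union_pairs_subset[of X] Union_pairs_subset[of Y]
    by (intro edge_iso_disjoint_Un[OF 1 2]) auto
qed

section \<open>Clique numbers of the extremal shapes\<close>

lemma clique_count_colex_shape:
  assumes "colex_shape c j E"
  shows "simple_edges E" "int (clique_count E) = colex_kappa ((c choose 2) + j)"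
proof -
  obtain X w D where E: "finite X" "card X = c" "D \<subseteq> X" "card D = j" "D \<noteq> {} \<longrightarrow> w \<notin> X"
    "E = pairs X \<union> star w D" using assms unfolding colex_shape_def by blast
  have finD: "finite D" using E finite_subset by blast
  have pX: "simple_edges (pairs X)" "int (clique_count (pairs X)) = colex_kappa (c choose 2)"
    using simple_edges_pairs clique_count_pairs E by auto
  have "simple_edges E \<and> int (clique_count E) = colex_kappa ((c choose 2) + j)"
  proof (cases "D = {}")
    case True
    then show ?thesis using E pX by auto
  next
    case False
    then have w: "w \<notin> X" "w \<notin> D" using E by auto
    have simple: "simple_edges E"
      unfolding E(6) using pX(1) finD w by (intro simple_edges_Un simple_edges_star)
    have "nbrs E w = D"
      using E w by (auto simp: nbrs_def star_def doubleton_eq_iff)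
    moreover have "avoiding E {w} = pairs X"
      using E w by (auto simp: avoiding_def star_def pairs_def)
    \<comment> \<open>The neighbourhood of \<open>w\<close> is complete, so the bound on the cliques
      through \<open>w\<close> is attained.\<close>
    moreover have "complete_on E D" using E by (auto simp: complete_on_def)
    ultimately have "clique_count E = clique_count (pairs X) + (2 ^ j - 1)"
      using clique_count_avoiding[OF simple, of "{w}"] card_cliques_at(2)[OF simple, of w] E(4) by simp
    then have "int (clique_count E) = int (clique_count (pairs X)) + int (2 ^ j - 1)" by presburger
    then have "int (clique_count E) = int (clique_count (pairs X)) + (2 ^ j - 1)" by simp
    moreover have "j \<le> c" using E card_mono by blast
    ultimately show ?thesis
      using simple pX(2) colex_kappa_eq[of j c] colex_kappa_choose_two[of c] by simp
  qed
  then show "simple_edges E" "int (clique_count E) = colex_kappa ((c choose 2) + j)" by auto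
qed

text \<open>An edge contributes one clique whether it stands alone or joins a new vertex to
  \<open>K_c\<close>, as \<open>2^1 - 1 = 1\<close>.\<close>

lemma clique_count_clique_plus_edge:
  assumes "clique_plus_edge c E" "1 \<le> c"
  shows "simple_edges E" "int (clique_count E) = colex_kappa ((c choose 2) + 1)"
proof -
  obtain X x y where E: "finite X" "card X = c" "x \<notin> X" "y \<notin> X" "x \<noteq> y" "E = pairs X \<union> pairs {x, y}"
    using assms(1) unfolding clique_plus_edge_def by (metis pairs_doubleton)
  have simple: "simple_edges (pairs X)" "simple_edges (pairs {x, y})"
    using E by (auto intro: simple_edges_pairs)
  then show "simple_edges E" unfolding E(6) by (rule simple_edges_Un)
  have "\<Union>(pairs X) \<inter> \<Union>(pairs {x, y}) = {}"
    using Union_pairs_subset[of X] Union_pairs_subset[of "{x, y}"] E by blast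
  then have "clique_count E = clique_count (pairs X) + clique_count (pairs {x, y})"
    unfolding E(6) by (rule clique_count_disjoint_Un[OF simple])
  moreover have "int (clique_count (pairs {x, y})) = colex_kappa (2 choose 2)"
    using clique_count_pairs[of "{x, y}"] E(5) by (simp add: numeral_2_eq_2)
  ultimately have "int (clique_count E) = colex_kappa (c choose 2) + colex_kappa (2 choose 2)"
    using clique_count_pairs[OF E(1)] E(2) by simp
  then show "int (clique_count E) = colex_kappa ((c choose 2) + 1)"
    using colex_kappa_eq[of 1 c] colex_kappa_choose_two[of c] colex_kappa_choose_two[of 2] assms(2) by simp
qed

lemma clique_count_with_cliques:
  assumes "with_cliques n P a E" "\<And>H. P H \<Longrightarrow> simple_edges H \<and> int (clique_count H) = k"
  shows "simple_edges E \<and> int (clique_count E) = int a * colex_kappa (n choose 2) + k"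
  using assms(1)
proof (induction a arbitrary: E)
  case 0
  then show ?case using assms(2) by simp
next
  case (Suc a)
  obtain Y F where E: "finite Y" "card Y = n" "Y \<inter> \<Union>F = {}" "E = F \<union> pairs Y" "with_cliques n P a F"
    using Suc.prems by auto
  have "\<Union>F \<inter> \<Union>(pairs Y) = {}" using E Union_pairs_subset[of Y] by blast
  then show ?case
    using Suc.IH[OF E(5)] E simple_edges_pairs[OF E(1)] clique_count_pairs[OF E(1)]
      clique_count_disjoint_Un[of F "pairs Y"] simple_edges_Un[of F "pairs Y"]
    by (simp add: algebra_simps)
qed

lemma with_cliques_SucI:
  assumes "with_cliques n P a F" "finite Y" "card Y = n" "Y \<inter> \<Union>F = {}"
  shows "with_cliques n P (Suc a) (F \<union> pairs Y)"
  unfolding with_cliques.simps using assms by (intro exI[of _ Y] exI[of _ F]) simp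

text \<open>A decomposition has a single remainder, so the alternative it satisfies can be moved
  outside.\<close>

lemma with_cliques_disj:
  assumes "with_cliques n (\<lambda>H. P H \<or> Q H) a E"
  shows "with_cliques n P a E \<or> with_cliques n Q a E"
  using assms
proof (induction a arbitrary: E)
  case (Suc a)
  then obtain Y F where *: "finite Y" "card Y = n" "Y \<inter> \<Union>F = {}" "E = F \<union> pairs Y"
    "with_cliques n P a F \<or> with_cliques n Q a F" by auto
  then show ?case using with_cliques_SucI by metis
qed simp

lemma with_cliques_mono:
  assumes "with_cliques n P a E" "\<And>H. P H \<Longrightarrow> Q H"
  shows "with_cliques n Q a E"
  using assms(1)
proof (induction a arbitrary: E)
  case (Suc a)
  then obtain Y F where *: "finite Y" "card Y = n" "Y \<inter> \<Union>F = {}" "E = F \<union> pairs Y"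
    "with_cliques n Q a F" by auto
  then show ?case using with_cliques_SucI by metis
qed (use assms(2) in simp)

lemma with_cliques_remainder: "with_cliques n P a E \<Longrightarrow> \<exists>H. P H"
  by (induction a arbitrary: E) auto

section \<open>The concrete graphs as edge sets\<close>

lemma edges_complete_graph: "edges (complete_graph n) = pairs {1..n}"
  by (simp add: complete_graph_def pairs_def)

text \<open>The injection \<phi> is general because the copies sit under one \<open>Inl\<close> next
  to the colex graph and under two in the left-nested union with \<open>K_c\<close> and
  \<open>K_2\<close>.\<close>

lemma with_cliques_copies:
  assumes "inj \<phi>" "range \<phi> \<inter> \<Union>H = {}" "P H"
  shows "with_cliques n P a ((`) \<phi> ` edges (copies a (complete_graph n)) \<union> H)"
proof (induction a)
  case 0
  then show ?case using assms(3) by (simp add: copies_def)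
next
  case (Suc a)
  let ?E = "\<lambda>a. (`) \<phi> ` edges (copies a (complete_graph n))" and ?Y = "(\<lambda>x. \<phi> (a, x)) ` {1..n}"
  have inj: "inj_on (\<lambda>x. \<phi> (a, x)) {1..n}" using assms(1) by (auto simp: inj_on_def)
  have "edges (copies (Suc a) (complete_graph n)) =
    edges (copies a (complete_graph n)) \<union> (`) (Pair a) ` pairs {1..n}"
    unfolding copies_def edges_complete_graph by (auto simp: less_Suc_eq)
  then have "?E (Suc a) = ?E a \<union> (`) \<phi> ` (`) (Pair a) ` pairs {1..n}" by (simp add: image_Un)
  also have "(`) \<phi> ` (`) (Pair a) ` pairs {1..n} = (`) (\<lambda>x. \<phi> (a, x)) ` pairs {1..n}"
    by (simp add: image_image)
  also have "\<dots> = pairs ?Y" using inj by (rule image_pairs)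
  finally have E: "?E (Suc a) \<union> H = (?E a \<union> H) \<union> pairs ?Y" by blast
  have "?Y \<inter> \<Union>(?E a) = {}"
    using assms(1) by (auto simp: copies_def dest: injD)
  then have "?Y \<inter> \<Union>(?E a \<union> H) = {}" using assms(2) by blast
  moreover have "finite ?Y" "card ?Y = n" using card_image[OF inj] by auto
  ultimately show ?case unfolding E using Suc by (intro with_cliques_SucI)
qed

text \<open>The predecessors are all pairs inside \<open>{1..k - 1}\<close> and the pairs
  \<open>{x, k}\<close> with \<open>x < i\<close>.\<close>

lemma card_colex_predecessors:
  assumes "1 \<le> i" "i < k"
  shows "card {f \<in> pos_pairs. colex_less f {i, k}} = ((k - 1) choose 2) + (i - 1)"
proof -
  have less: "colex_less {x, y} {i, k} \<longleftrightarrow> y < k \<or> y = k \<and> x < i" if "x < y" for x y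
    using that assms by (auto simp: colex_less_def doubleton_eq_iff)
  have "{f \<in> pos_pairs. colex_less f {i, k}} = pairs {1..k - 1} \<union> star k {1..<i}"
  proof (intro equalityI subsetI)
    fix f assume "f \<in> {f \<in> pos_pairs. colex_less f {i, k}}"
    then obtain x y where "f = {x, y}" "1 \<le> x" "x < y" "y < k \<or> y = k \<and> x < i"
      using less by (auto simp: pos_pairs_def)
    then show "f \<in> pairs {1..k - 1} \<union> star k {1..<i}" by (auto simp: star_def)
  next
    fix f assume "f \<in> pairs {1..k - 1} \<union> star k {1..<i}"
    then obtain x y where xy: "f = {x, y}" "1 \<le> x" "x < y" "y < k \<or> y = k \<and> x < i"
    proof
      assume "f \<in> pairs {1..k - 1}"
      then obtain x y where "f = {x, y}" "x \<noteq> y" "x \<in> {1..k - 1}" "y \<in> {1..k - 1}"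
        by (auto simp: pairs_def card_2_iff)
      moreover have "{x, y} = {y, x}" by blast
      moreover have "x < k" "y < k" using calculation assms by auto
      ultimately show thesis using that[of x y] that[of y x] by (cases "x < y") auto
    next
      assume "f \<in> star k {1..<i}"
      then obtain x where "f = {k, x}" "x \<in> {1..<i}" by (auto simp: star_def)
      moreover from this have "f = {x, k}" by blast
      ultimately show thesis using that[of x k] assms by auto
    qed
    then have "f \<in> pos_pairs" by (auto simp: pos_pairs_def)
    then show "f \<in> {f \<in> pos_pairs. colex_less f {i, k}}" using xy less by auto
  qed
  also have "card \<dots> = card (pairs {1..k - 1}) + card (star k {1..<i})"
    using assms by (intro card_Un_disjoint) (auto simp: star_def pairs_def)
  finally show ?thesis using assms by (simp add: card_pairs card_star)
qed

lemma edges_colex_graph: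
  assumes "j < c"
  shows "edges (colex_graph ((c choose 2) + j)) = pairs {1..c} \<union> star (Suc c) {1..j}"
proof -
  have mem: "{i, k} \<in> edges (colex_graph ((c choose 2) + j)) \<longleftrightarrow> k \<le> c \<or> k = Suc c \<and> i \<le> j"
    if ik: "1 \<le> i" "i < k" for i k
  proof -
    have "{i, k} \<in> edges (colex_graph ((c choose 2) + j)) \<longleftrightarrow>
      ((k - 1) choose 2) + (i - 1) < (c choose 2) + j"
      using ik card_colex_predecessors[OF ik] by (auto simp: colex_graph_def pos_pairs_def)
    also have "\<dots> \<longleftrightarrow> k \<le> c \<or> k = Suc c \<and> i \<le> j"
    proof -
      consider "k \<le> c" | "k = Suc c" | "Suc (Suc c) \<le> k" by linarith
      then show ?thesis
      proof cases
        case 1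
        \<comment> \<open>All pairs with larger element \<open>k\<close> are among the first
          \<open>k choose 2\<close>, hence among the first \<open>c choose 2\<close>.\<close>
        then have "Suc (k - 1) choose 2 \<le> c choose 2" using ik by (intro choose_two_mono) simp
        then have "((k - 1) choose 2) + (k - 1) \<le> c choose 2" by (simp only: choose_two_Suc)
        then show ?thesis using 1 ik by linarith
      next
        case 2
        then show ?thesis using ik by auto
      next
        case 3
        then have "Suc c choose 2 \<le> (k - 1) choose 2" by (intro choose_two_mono) simp
        then show ?thesis using 3 assms by (simp add: choose_two_Suc)
      qed
    qed
    finally show ?thesis .
  qed
  show ?thesis
  proof (intro equalityI subsetI)
    fix e assume e: "e \<in> edges (colex_graph ((c choose 2) + j))"
    then obtain i k where ik: "e = {i, k}" "1 \<le> i" "i < k" by (auto simp: colex_graph_def pos_pairs_def)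
    then have "k \<le> c \<or> k = Suc c \<and> i \<le> j" using mem e by simp
    then show "e \<in> pairs {1..c} \<union> star (Suc c) {1..j}" using ik by (auto simp: star_def)
  next
    fix e assume "e \<in> pairs {1..c} \<union> star (Suc c) {1..j}"
    then show "e \<in> edges (colex_graph ((c choose 2) + j))"
    proof
      assume "e \<in> pairs {1..c}"
      then obtain x y where "e = {x, y}" "x \<noteq> y" "x \<in> {1..c}" "y \<in> {1..c}"
        by (auto simp: pairs_def card_2_iff)
      then show ?thesis using mem[of x y] mem[of y x] by (cases "x < y") (auto simp: insert_commute)
    next
      assume "e \<in> star (Suc c) {1..j}"
      then obtain x where "e = {Suc c, x}" "x \<in> {1..j}" by (auto simp: star_def)
      moreover from this have "e = {x, Suc c}" by blast
      ultimately show ?thesis using mem[of x "Suc c"] assms by auto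
    qed
  qed
qed

lemma colex_shape_image:
  assumes "colex_shape c j E" "inj f"
  shows "colex_shape c j ((`) f ` E)"
proof -
  obtain X w D where E: "finite X" "card X = c" "D \<subseteq> X" "card D = j" "D \<noteq> {} \<longrightarrow> w \<notin> X"
    "E = pairs X \<union> star w D" using assms(1) unfolding colex_shape_def by blast
  have inj: "inj_on f S" for S using assms(2) inj_on_subset by blast
  have "(`) f ` E = pairs (f ` X) \<union> star (f w) (f ` D)"
    unfolding E(6) by (simp add: image_Un image_pairs[OF inj] image_star)
  moreover have "card (f ` X) = c" "card (f ` D) = j" using card_image[OF inj] E by auto
  moreover have "f ` D \<noteq> {} \<longrightarrow> f w \<notin> f ` X" using E assms(2) by (auto dest: injD)
  moreover have "finite (f ` X)" "f ` D \<subseteq> f ` X" using E(1,3) by auto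
  ultimately show ?thesis
    unfolding colex_shape_def
    by (intro exI[of _ "f ` X"] exI[of _ "f w"] exI[of _ "f ` D"]) simp
qed

lemma with_cliques_colex:
  assumes "j < c"
  shows "with_cliques n (colex_shape c j) a
    (edges (copies a (complete_graph n) \<uplus> colex_graph ((c choose 2) + j)))"
proof -
  have "colex_shape c j (pairs {1..c} \<union> star (Suc c) {1..j})"
    unfolding colex_shape_def using assms
    by (intro exI[of _ "{1..c}"] exI[of _ "Suc c"] exI[of _ "{1..j}"]) auto
  then have "colex_shape c j ((`) Inr ` edges (colex_graph ((c choose 2) + j)))"
    unfolding edges_colex_graph[OF assms] by (rule colex_shape_image) simp
  then show ?thesis
    unfolding disj_union_def graph.simps
    by (intro with_cliques_copies) auto
qed

lemma with_cliques_plus_edge: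
  "with_cliques n (clique_plus_edge c) a
    (edges (copies a (complete_graph n) \<uplus> complete_graph c \<uplus> complete_graph 2))"
proof -
  let ?X = "Inl ` Inr ` {1..c} :: (((nat \<times> nat) + nat) + nat) set"
  let ?H = "pairs ?X \<union> {{Inr 1, Inr 2}}"
  have "inj_on (\<lambda>x. Inl (Inr x) :: ((nat \<times> nat) + nat) + nat) {1..c}" by (simp add: inj_on_def)
  from image_pairs[OF this] have pX: "(`) (\<lambda>x. Inl (Inr x)) ` pairs {Suc 0..c} = pairs ?X"
    by (simp add: image_image)
  have inj: "inj_on f S" if "inj f" for f :: "'x \<Rightarrow> 'y" and S using that inj_on_subset by blast
  have "{1..2} = {1, 2 :: nat}" by auto
  then have "pairs {1..2} = {{1, 2 :: nat}}" by (simp add: pairs_doubleton)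
  then have "edges (copies a (complete_graph n) \<uplus> complete_graph c \<uplus> complete_graph 2) =
    (`) (Inl \<circ> Inl) ` edges (copies a (complete_graph n)) \<union> ?H"
    unfolding disj_union_def edges_complete_graph
    by (simp add: image_Un image_image image_comp pX)
  moreover have "card ?X = c" by (simp add: card_image inj)
  then have "clique_plus_edge c ?H"
    unfolding clique_plus_edge_def
    by (intro exI[of _ ?X] exI[of _ "Inr 1"] exI[of _ "Inr 2"]) auto
  moreover have "range (Inl \<circ> Inl) \<inter> \<Union>?H = {}" using Union_pairs_subset[of ?X] by auto
  ultimately show ?thesis by (metis with_cliques_copies inj_Inl inj_compose)
qed

section \<open>Transfer from edge sets to graphs\<close>

lemma kappa_eq_clique_count:
  assumes "simple_graph G" "finite (edges G)"
  shows "kappa G = clique_count (edges G)"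
proof -
  have "{S. is_clique G S \<and> finite S \<and> 2 \<le> card S} = cliques (edges G)"
  proof (intro equalityI subsetI)
    fix S assume "S \<in> cliques (edges G)"
    moreover from this have "S \<subseteq> \<Union>(edges G)" by (rule clique_subset_Union)
    ultimately show "S \<in> {S. is_clique G S \<and> finite S \<and> 2 \<le> card S}"
      using assms(1) by (auto simp: is_clique_def cliques_def complete_on_def simple_graph_def)
  qed (auto simp: is_clique_def cliques_def complete_on_def)
  then show ?thesis using kappa_eq_card[OF assms] by (simp add: clique_count_def)
qed

lemma simple_graph_disj_union:
  "simple_graph G \<Longrightarrow> simple_graph H \<Longrightarrow> simple_graph (G \<uplus> H)"
  by (fastforce simp: simple_graph_def disj_union_def card_image)

lemma simple_graph_copies: "simple_graph G \<Longrightarrow> simple_graph (copies a G)"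
  by (fastforce simp: simple_graph_def copies_def card_image inj_on_def)

lemma simple_graph_complete_graph: "simple_graph (complete_graph n)"
  by (simp add: simple_graph_def complete_graph_def)

lemma simple_graph_colex_graph: "simple_graph (colex_graph b)"
  by (auto simp: simple_graph_def colex_graph_def pos_pairs_def)

theorem mainTheorem1:
  fixes m r a b :: nat and G :: "'a graph"
  assumes "r \<ge> 1"
    and "m = a * ((r + 1) choose 2) + b"
    and "b < (r + 1) choose 2"
    and "simple_graph G"
    and "finite (verts G)"
    and "card (edges G) = m"
    and "max_degree G \<le> r"
  shows "kappa G \<le> kappa (copies a (complete_graph (r + 1)) \<uplus> colex_graph b) \<and>
    (kappa G = kappa (copies a (complete_graph (r + 1)) \<uplus> colex_graph b) \<longleftrightarrow>
      iso_upto_isolated G (copies a (complete_graph (r + 1)) \<uplus> colex_graph b) \<or>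
      (\<exists>c. c \<ge> 2 \<and> b = (c choose 2) + 1 \<and>
        iso_upto_isolated G
          (copies a (complete_graph (r + 1)) \<uplus> complete_graph c \<uplus> complete_graph 2)))"
proof -
  let ?N = "Suc r choose 2"
  let ?H = "copies a (complete_graph (r + 1)) \<uplus> colex_graph b"
  let ?K = "\<lambda>c. copies a (complete_graph (r + 1)) \<uplus> complete_graph c \<uplus> complete_graph 2"
  let ?bound = "int a * colex_kappa ?N + colex_kappa b"
  have sH: "simple_graph ?H" and sK: "simple_graph (?K c)" for c
    by (intro simple_graph_disj_union simple_graph_copies simple_graph_complete_graph
        simple_graph_colex_graph)+
  have "edges G \<subseteq> Pow (verts G)" using assms(4) by (auto simp: simple_graph_def)
  then have finG: "finite (edges G)" using assms(5) finite_subset by blast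
  have simple: "simple_edges (edges G)" using assms(4) finG by (simp add: simple_graph_def simple_edges_def)
  have deg: "card (nbrs (edges G) v) \<le> r" for v
  proof (cases "v \<in> verts G")
    case True
    then have "degree G v \<le> max_degree G" unfolding max_degree_def using assms(5) by (intro Max_ge) auto
    then show ?thesis using assms(7) card_edges_at[OF simple, of v] by (simp add: degree_def)
  next
    case False
    then have "nbrs (edges G) v = {}" using assms(4) by (auto simp: nbrs_def simple_graph_def)
    then show ?thesis by simp
  qed
  have kG: "kappa G = clique_count (edges G)" using assms(4) finG by (rule kappa_eq_clique_count)
  obtain c j where c: "b = (c choose 2) + j" "j < c" using colex_representation by blast
  have wH: "with_cliques (Suc r) (colex_shape c j) a (edges ?H)"
    using with_cliques_colex[OF c(2), of "r + 1" a] c(1) by simp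
  have countH: "simple_edges (edges ?H) \<and> int (clique_count (edges ?H)) = ?bound"
    unfolding c(1) by (rule clique_count_with_cliques[OF wH[unfolded c(1)]])
      (use clique_count_colex_shape in blast)
  then have kH: "kappa ?H = clique_count (edges ?H)"
    using sH by (intro kappa_eq_clique_count) (auto simp: simple_edges_def)
  have bound: "int (clique_count (edges G)) \<le> ?bound"
    and extremal: "int (clique_count (edges G)) = ?bound \<Longrightarrow>
      with_cliques (Suc r) (extremal_remainder b) a (edges G)"
    using clique_count_bound[OF simple assms(1) deg] assms(2,3,6) by auto
  have "iso_upto_isolated G ?H \<or> (\<exists>c\<ge>2. b = (c choose 2) + 1 \<and> iso_upto_isolated G (?K c))"
    if "int (clique_count (edges G)) = ?bound"
  proof -
    have "with_cliques (Suc r) (\<lambda>H. colex_shape c j H \<or> j = 1 \<and> 2 \<le> c \<and> clique_plus_edge c H) a (edges G)"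
      using extremal[OF that] extremal_remainder_cases[OF _ c(2)] unfolding c(1) by (rule with_cliques_mono)
    then consider "with_cliques (Suc r) (colex_shape c j) a (edges G)"
      | "with_cliques (Suc r) (\<lambda>H. j = 1 \<and> 2 \<le> c \<and> clique_plus_edge c H) a (edges G)"
      by (elim with_cliques_disj[THEN disjE])
    then show ?thesis
    proof cases
      case 1
      then have "edge_iso (edges G) (edges ?H)"
        using wH edge_iso_colex_shape by (rule edge_iso_with_cliques)
      then show ?thesis using iso_upto_isolated_iff_edge_iso[OF assms(4) sH] by blast
    next
      case 2
      \<comment> \<open>The numerical conditions are part of the predicate on the remainder, so any
        witness for the remainder yields them.\<close>
      have jc: "j = 1 \<and> 2 \<le> c"
        using with_cliques_remainder[OF 2] by blast
      have "with_cliques (Suc r) (clique_plus_edge c) a (edges G)"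
        using 2 by (rule with_cliques_mono) simp
      moreover have "with_cliques (Suc r) (clique_plus_edge c) a (edges (?K c))"
        using with_cliques_plus_edge[of "r + 1" c a] by simp
      ultimately have "edge_iso (edges G) (edges (?K c))"
        using edge_iso_clique_plus_edge by (rule edge_iso_with_cliques)
      then have "iso_upto_isolated G (?K c)"
        using iso_upto_isolated_iff_edge_iso[OF assms(4) sK] by blast
      then show ?thesis using c jc by blast
    qed
  qed
  moreover have "int (clique_count (edges G)) = ?bound" if "iso_upto_isolated G ?H"
    using that iso_upto_isolated_iff_edge_iso[OF assms(4) sH] clique_count_edge_iso countH by metis
  moreover have "int (clique_count (edges G)) = ?bound"
    if "iso_upto_isolated G (?K e)" "2 \<le> e" "b = (e choose 2) + 1" for e
  proof -
    have "with_cliques (Suc r) (clique_plus_edge e) a (edges (?K e))"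
      using with_cliques_plus_edge[of "r + 1" e a] by simp
    moreover have "simple_edges H \<and> int (clique_count H) = colex_kappa b" if "clique_plus_edge e H" for H
      using clique_count_clique_plus_edge[OF that] \<open>2 \<le> e\<close> \<open>b = (e choose 2) + 1\<close> by simp
    ultimately have "int (clique_count (edges (?K e))) = ?bound"
      using clique_count_with_cliques by blast
    then show ?thesis
      using that(1) iso_upto_isolated_iff_edge_iso[OF assms(4) sK] clique_count_edge_iso by metis
  qed
  ultimately show ?thesis using bound countH unfolding kG kH by (metis of_nat_eq_iff of_nat_le_iff)
qed

end
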